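(* Let $B$ be a Martin-Löf random path (a Martin-Löf random element of $C[0,1]$ with respect to Wiener measure), and let $Z_B=\{t : B(t)=0\}$. Then every $x \in Z_B\setminus\{0\}$ has effective Hausdorff dimension $\mathrm{cdim}(x)\geq 1/2$.
   Context: $C[0,1]$ is the space of continuous real functions on $[0,1]$ with the sup norm, equipped with Wiener measure $\Pr$ (the law of standard one-dimensional Brownian motion started at $0$); this is a computable probability space, and Martin-Löf randomness is taken with respect to it. Reals are identified with their binary expansions; for a real $x$, $x\upharpoonright n$ denotes the first $n$ bits. The effective Hausdorff dimension of $x$ is $\mathrm{cdim}(x)=\liminf_n K(x\upharpoonright n)/n$, where $K$ is prefix-free Kolmogorov complexity. *)

theory Defs
  imports "HOL-Probability.Probability" "HOL-Library.Sublist"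
begin

section \<open>Computability\<close>

text \<open>
  The partial recursive functions of one natural argument; tuples are coded by \<^const>\<open>prod_encode\<close>.
\<close>

definition minimize :: "(nat \<Rightarrow> nat option) \<Rightarrow> nat \<Rightarrow> nat option" where
  "minimize f a =
     (if \<exists>n. f (prod_encode (a, n)) = Some 0 \<and> (\<forall>m<n. f (prod_encode (a, m)) \<noteq> None)
      then Some (LEAST n. f (prod_encode (a, n)) = Some 0) else None)"

fun prim_rec :: "(nat \<Rightarrow> nat option) \<Rightarrow> (nat \<Rightarrow> nat option) \<Rightarrow> nat \<Rightarrow> nat \<Rightarrow> nat option" where
  "prim_rec f g a 0 = f a"
| "prim_rec f g a (Suc k) =
     Option.bind (prim_rec f g a k) (\<lambda>r. g (prod_encode (a, prod_encode (k, r))))"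

inductive partial_recursive :: "(nat \<Rightarrow> nat option) \<Rightarrow> bool" where
  zero: "partial_recursive (\<lambda>n. Some 0)"
| succ: "partial_recursive (\<lambda>n. Some (Suc n))"
| left: "partial_recursive (\<lambda>n. Some (fst (prod_decode n)))"
| right: "partial_recursive (\<lambda>n. Some (snd (prod_decode n)))"
| pair: "partial_recursive f \<Longrightarrow> partial_recursive g \<Longrightarrow>
    partial_recursive
      (\<lambda>n. Option.bind (f n) (\<lambda>a. Option.bind (g n) (\<lambda>b. Some (prod_encode (a, b)))))"
| comp: "partial_recursive f \<Longrightarrow> partial_recursive g \<Longrightarrow>
    partial_recursive (\<lambda>n. Option.bind (g n) f)"
| prec: "partial_recursive f \<Longrightarrow> partial_recursive g \<Longrightarrow>
    partial_recursive (\<lambda>n. prim_rec f g (fst (prod_decode n)) (snd (prod_decode n)))"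
| mu: "partial_recursive f \<Longrightarrow> partial_recursive (minimize f)"

definition comp_enum :: "nat set \<Rightarrow> bool" where
  "comp_enum A \<longleftrightarrow> (\<exists>f. partial_recursive f \<and> A = dom f)"

definition string_code :: "bool list \<Rightarrow> nat" where
  "string_code p = list_encode (map of_bool p)"

definition partial_computable :: "(bool list \<Rightarrow> bool list option) \<Rightarrow> bool" where
  "partial_computable M \<longleftrightarrow>
     (\<exists>f. partial_recursive f \<and> (\<forall>p. f (string_code p) = map_option string_code (M p)))"


section \<open>Prefix-free complexity and effective dimension\<close>

definition prefix_free_machine :: "(bool list \<Rightarrow> bool list option) \<Rightarrow> bool" where
  "prefix_free_machine M \<longleftrightarrow>
     partial_computable M \<and> (\<forall>p\<in>dom M. \<forall>q\<in>dom M. prefix p q \<longrightarrow> p = q)"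

text \<open>The value is \<open>\<infinity>\<close> when the string has no description.\<close>

definition complexity :: "(bool list \<Rightarrow> bool list option) \<Rightarrow> bool list \<Rightarrow> enat" where
  "complexity M \<sigma> = (INF p\<in>{p. M p = Some \<sigma>}. enat (length p))"

text \<open>
  Prefix-free Kolmogorov complexity \<open>K\<close> is \<^term>\<open>complexity U\<close> for any optimal \<open>U\<close>;
  two optimal machines give the same \<open>K\<close> up to an additive constant, hence the same dimension.
\<close>

definition optimal_prefix_free_machine :: "(bool list \<Rightarrow> bool list option) \<Rightarrow> bool" where
  "optimal_prefix_free_machine U \<longleftrightarrow>
     prefix_free_machine U \<and>
     (\<forall>M. prefix_free_machine M \<longrightarrow>
        (\<exists>c::nat. \<forall>\<sigma>. complexity U \<sigma> \<le> complexity M \<sigma> + enat c))"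

text \<open>
  The first \<open>n\<close> bits of the fractional part of a real; dyadic rationals get the expansion
  ending in zeros.
\<close>

definition bits :: "real \<Rightarrow> nat \<Rightarrow> bool list" where
  "bits x n = map (\<lambda>i. odd \<lfloor>x * 2 ^ Suc i\<rfloor>) [0..<n]"

definition cdim :: "(bool list \<Rightarrow> bool list option) \<Rightarrow> real \<Rightarrow> ereal" where
  "cdim U x = liminf (\<lambda>n. ereal_of_enat (complexity U (bits x n)) / ereal (real n))"


section \<open>Martin-Loef randomness in a computable metric space\<close>

text \<open>
  The metric space \<open>X\<close> comes with a numbered dense sequence \<open>s\<close> of ideal points; basic open
  sets are the balls around ideal points with rational radii (empty for nonpositive radii).
  \<open>E\<close> enumerates, uniformly in \<open>n\<close>, the basic balls whose union is \<open>V n\<close>.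
\<close>

definition unif_eff_open :: "'a metric \<Rightarrow> (nat \<Rightarrow> 'a) \<Rightarrow> (nat \<Rightarrow> 'a set) \<Rightarrow> bool" where
  "unif_eff_open X s V \<longleftrightarrow>
     (\<exists>E. comp_enum E \<and>
        (\<forall>n. V n = (\<Union>(i, k)\<in>{(i, k). prod_encode (n, prod_encode (i, k)) \<in> E}.
                      mball_of X (s i) (of_rat (nat_to_rat_surj k)))))"

definition ml_test :: "'a metric \<Rightarrow> (nat \<Rightarrow> 'a) \<Rightarrow> 'a measure \<Rightarrow> (nat \<Rightarrow> 'a set) \<Rightarrow> bool" where
  "ml_test X s P V \<longleftrightarrow>
     unif_eff_open X s V \<and> (\<forall>n. emeasure P (V n) \<le> ennreal ((1 / 2) ^ n))"

definition ml_random :: "'a metric \<Rightarrow> (nat \<Rightarrow> 'a) \<Rightarrow> 'a measure \<Rightarrow> 'a \<Rightarrow> bool" where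
  "ml_random X s P x \<longleftrightarrow> x \<in> mspace X \<and> (\<forall>V. ml_test X s P V \<longrightarrow> x \<notin> (\<Inter>n. V n))"


section \<open>Wiener space\<close>

abbreviation C01 :: "(real \<Rightarrow> real) metric" where
  "C01 \<equiv> cfunspace (top_of_set {0..1}) euclidean_metric"

lemma mspace_C01:
  "mspace C01 = {f. continuous_on {0..1} f \<and> f \<in> extensional {0..1}}"
proof -
  have "bounded (f ` {0..1})" if "continuous_on {0..1} f" for f :: "real \<Rightarrow> real"
    using that by (intro compact_imp_bounded compact_continuous_image) auto
  then show ?thesis
    by (auto simp: mspace_cfunspace Metric_space.fspace_def)
qed

lemma mdist_C01:
  assumes "f \<in> mspace C01" "g \<in> mspace C01"
  shows "mdist C01 f g = (SUP t\<in>{0..1}. \<bar>f t - g t\<bar>)"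
proof -
  have "f \<in> Metric_space.fspace UNIV dist {0..1}" "g \<in> Metric_space.fspace UNIV dist {0..1}"
    using assms by (auto simp: cfunspace_def)
  then show ?thesis
    by (simp add: cfunspace_def dist_real_def Metric_space.fdist_def[OF Met_TC.Metric_space_axioms])
qed

text \<open>
  Ideal points: polynomials with rational coefficients, \<open>n\<close> coding the list of coefficients.
\<close>

definition rat_poly :: "nat \<Rightarrow> real \<Rightarrow> real" where
  "rat_poly n =
     restrict (\<lambda>t. horner_sum (\<lambda>k. of_rat (nat_to_rat_surj k)) t (list_decode n)) {0..1}"

lemma rat_poly_in_C01: "rat_poly n \<in> mspace C01"
proof -
  have "continuous_on {0..1}
      (\<lambda>t::real. horner_sum (\<lambda>k. of_rat (nat_to_rat_surj k)) t ks)" for ks :: "nat list"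
    by (induction ks) (auto intro!: continuous_intros)
  then have "continuous_on {0..1} (rat_poly n)"
    unfolding rat_poly_def by (subst continuous_on_cong[OF refl]) (auto intro: restrict_apply')
  then show ?thesis
    unfolding mspace_C01 by (simp add: rat_poly_def)
qed

lemma rat_poly_dense:
  assumes f: "f \<in> mspace C01" and e: "e > 0"
  shows "\<exists>n. mdist C01 f (rat_poly n) < e"
proof -
  have "continuous_on {0..1} f"
    using f by (simp add: mspace_C01 del: mspace_cfunspace)
  then obtain g where g: "real_polynomial_function g" "\<And>t. t \<in> {0..1} \<Longrightarrow> \<bar>f t - g t\<bar> < e / 4"
    using Stone_Weierstrass_real_polynomial_function[of "{0..1}" f "e / 4"] e by auto
  then obtain a :: "nat \<Rightarrow> real" and N where a: "g = (\<lambda>x. \<Sum>i\<le>N. a i * x ^ i)"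
    unfolding real_polynomial_function_iff_sum by blast
  have "\<exists>k. \<bar>a i - of_rat (nat_to_rat_surj k)\<bar> < e / (4 * Suc N)" for i
  proof -
    have "a i < a i + e / (4 * Suc N)"
      using e by simp
    from of_rat_dense[OF this] obtain q where "a i < of_rat q" "of_rat q < a i + e / (4 * Suc N)"
      by blast
    moreover obtain k where "q = nat_to_rat_surj k"
      using surj_nat_to_rat_surj by blast
    ultimately show ?thesis
      by (intro exI[of _ k]) auto
  qed
  then obtain k where k: "\<And>i. \<bar>a i - of_rat (nat_to_rat_surj (k i))\<bar> < e / (4 * Suc N)"
    by metis
  define n where "n = list_encode (map k [0..<Suc N])"
  have "\<bar>f t - rat_poly n t\<bar> \<le> e / 2" if t: "t \<in> {0..1}" for t
  proof -
    have "rat_poly n t = (\<Sum>i<Suc N. of_rat (nat_to_rat_surj (k i)) * t ^ i)"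
      using t by (simp add: rat_poly_def n_def horner_sum_eq_sum atLeast0LessThan del: upt_Suc)
    then have "g t - rat_poly n t = (\<Sum>i<Suc N. (a i - of_rat (nat_to_rat_surj (k i))) * t ^ i)"
      by (simp only: a lessThan_Suc_atMost sum_subtractf[symmetric] left_diff_distrib)
    also have "\<bar>\<dots>\<bar> \<le> (\<Sum>i<Suc N. e / (4 * Suc N))"
    proof (intro order.trans[OF sum_abs] sum_mono)
      fix i
      have "\<bar>a i - of_rat (nat_to_rat_surj (k i))\<bar> * \<bar>t ^ i\<bar> \<le> e / (4 * Suc N) * 1"
        using k[of i] t e by (intro mult_mono) (auto simp: power_le_one)
      then show "\<bar>(a i - of_rat (nat_to_rat_surj (k i))) * t ^ i\<bar> \<le> e / (4 * Suc N)"
        by (simp add: abs_mult)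
    qed
    also have "\<dots> = e / 4"
      by (simp add: field_simps)
    finally show ?thesis
      using g(2)[OF t] by linarith
  qed
  then have "mdist C01 f (rat_poly n) \<le> e / 2"
    unfolding mdist_C01[OF f rat_poly_in_C01] by (intro cSUP_least) auto
  then show ?thesis
    using e by (intro exI[of _ n]) linarith
qed

definition metric_borel :: "'a metric \<Rightarrow> 'a measure" where
  "metric_borel X = sigma (mspace X) {V. openin (mtopology_of X) V}"

text \<open>
  The law of standard Brownian motion started at 0, given by its defining properties, which
  determine \<open>P\<close> uniquely on the Borel sets of \<^term>\<open>C01\<close>.
\<close>

definition wiener_measure :: "(real \<Rightarrow> real) measure \<Rightarrow> bool" where
  "wiener_measure P \<longleftrightarrow>
     prob_space P \<and> sets P = sets (metric_borel C01) \<and>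
     (AE f in P. f 0 = 0) \<and>
     (\<forall>s t. 0 \<le> s \<and> s < t \<and> t \<le> 1 \<longrightarrow>
        distributed P lborel (\<lambda>f. f t - f s) (normal_density 0 (sqrt (t - s)))) \<and>
     (\<forall>n (\<tau> :: nat \<Rightarrow> real). (\<forall>i\<le>n. \<tau> i \<in> {0..1}) \<and> (\<forall>i<n. \<tau> i < \<tau> (Suc i)) \<longrightarrow>
        prob_space.indep_vars P (\<lambda>_. borel) (\<lambda>i f. f (\<tau> (Suc i)) - f (\<tau> i)) {..<n})"

end

theory Submission
  imports Defs
begin

text \<open>
  Suppose \<open>cdim x < 1/2\<close>, so that for some \<open>L\<close> infinitely many truncations \<open>a\<close> of \<open>x\<close>, at
  levels \<open>n\<close>, have a program of length at most \<open>(1/2 - 1/L) n\<close>. Let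
  \<open>e n = \<lfloor>(1/2 - 1/(2L)) n\<rfloor>\<close>. By a high moment bound and Borel--Cantelli, the increments of a
  random path \<open>B\<close> between neighbouring dyadic points of level \<open>n\<close> are at most \<open>2^(- e n)\<close>
  for all large \<open>n\<close>, and chaining from a zero \<open>x\<close> gives \<open>|B a| \<le> C 2^(- e n)\<close>. On the
  other hand \<open>B a\<close> has bounded density for \<open>a\<close> away from \<open>0\<close>, and at most
  \<open>2^((1/2 - 1/L) n + 1)\<close> points of level \<open>n\<close> have such short programs; so, again by
  Borel--Cantelli, \<open>|B a| > C 2^(- e n)\<close> at all of them once \<open>n\<close> is large. The binary digits
  of \<open>1\<close> in the sense of \<^const>\<open>bits\<close> are all \<open>0\<close>, so \<open>B 1 \<noteq> 0\<close> is a separate (trivial) test.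
\<close>

section \<open>Recursive functions\<close>

named_theorems recfn_intro

definition recfn :: "(nat \<Rightarrow> nat) \<Rightarrow> bool" where
  "recfn f \<longleftrightarrow> partial_recursive (\<lambda>n. Some (f n))"

lemma recfn_fst_decode: "recfn (\<lambda>n. fst (prod_decode n))"
  and recfn_snd_decode: "recfn (\<lambda>n. snd (prod_decode n))"
  unfolding recfn_def by (rule partial_recursive.intros)+

lemma recfn_comp:
  assumes "recfn f" "recfn g" shows "recfn (\<lambda>n. f (g n))"
  using partial_recursive.comp[OF assms[unfolded recfn_def]] by (simp add: recfn_def)

lemma recfn_pair [recfn_intro]:
  assumes "recfn f" "recfn g" shows "recfn (\<lambda>n. prod_encode (f n, g n))"
  using partial_recursive.pair[OF assms[unfolded recfn_def]] by (simp add: recfn_def)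

lemma recfn_fst [recfn_intro]: "recfn f \<Longrightarrow> recfn (\<lambda>n. fst (prod_decode (f n)))"
  by (rule recfn_comp[OF recfn_fst_decode])

lemma recfn_snd [recfn_intro]: "recfn f \<Longrightarrow> recfn (\<lambda>n. snd (prod_decode (f n)))"
  by (rule recfn_comp[OF recfn_snd_decode])

lemma recfn_id [recfn_intro]: "recfn (\<lambda>n. n)"
  using recfn_pair[OF recfn_fst_decode recfn_snd_decode] by simp

lemma recfn_Suc [recfn_intro]: "recfn f \<Longrightarrow> recfn (\<lambda>n. Suc (f n))"
  by (rule recfn_comp[of Suc]) (simp_all add: recfn_def partial_recursive.succ)

lemma recfn_const [recfn_intro]: "recfn (\<lambda>n. c)"
proof (induction c)
  case 0
  then show ?case by (simp add: recfn_def partial_recursive.zero)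
qed (rule recfn_Suc)

definition recfn2 :: "(nat \<Rightarrow> nat \<Rightarrow> nat) \<Rightarrow> bool" where
  "recfn2 F \<longleftrightarrow> recfn (\<lambda>z. F (fst (prod_decode z)) (snd (prod_decode z)))"

lemma recfn2_comp:
  assumes "recfn2 F" "recfn f" "recfn g" shows "recfn (\<lambda>n. F (f n) (g n))"
  using recfn_comp[OF assms(1)[unfolded recfn2_def] recfn_pair[OF assms(2,3)]] by simp

text \<open>The second assumption reads its argument as \<open>(a, (k, r))\<close>: parameter,
  counter and previous value, in the nesting that \<open>prim_rec\<close> hands to its step
  function.\<close>

lemma recfn2_rec_nat:
  assumes "recfn f" "recfn (\<lambda>z. G (fst (prod_decode z)) (fst (prod_decode (snd (prod_decode z))))
                                   (snd (prod_decode (snd (prod_decode z)))))"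
  shows "recfn2 (\<lambda>a. rec_nat (f a) (G a))"
proof -
  let ?g = "\<lambda>z. G (fst (prod_decode z)) (fst (prod_decode (snd (prod_decode z))))
                  (snd (prod_decode (snd (prod_decode z))))"
  have "prim_rec (\<lambda>n. Some (f n)) (\<lambda>n. Some (?g n)) a k = Some (rec_nat (f a) (G a) k)" for a k
    by (induction k) auto
  then show ?thesis
    using partial_recursive.prec[OF assms[unfolded recfn_def]] by (simp add: recfn_def recfn2_def)
qed

lemma recfn2_recI:
  assumes "recfn f"
    and "recfn (\<lambda>z. G (fst (prod_decode z)) (fst (prod_decode (snd (prod_decode z))))
                         (snd (prod_decode (snd (prod_decode z)))))"
    and "\<And>a. F a 0 = f a" "\<And>a k. F a (Suc k) = G a k (F a k)"
  shows "recfn2 F"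
proof -
  have "F a k = rec_nat (f a) (G a) k" for a k
    by (induction k) (auto simp: assms(3,4))
  then have "F = (\<lambda>a. rec_nat (f a) (G a))" by blast
  then show ?thesis using recfn2_rec_nat[OF assms(1,2)] by simp
qed

lemma recfn_add [recfn_intro]: "recfn f \<Longrightarrow> recfn g \<Longrightarrow> recfn (\<lambda>n. f n + g n)"
  by (rule recfn2_comp[of "(+)"], rule recfn2_recI[where G = "\<lambda>a k r. Suc r" and f = "\<lambda>a. a"]) (simp | intro recfn_intro)+

text \<open>The recursion runs over the second argument of a two-place function, so the parameter is
  a dummy 0. Predecessor then serves as the recursion step of truncated subtraction.\<close>

lemma recfn_pred [recfn_intro]: "recfn f \<Longrightarrow> recfn (\<lambda>n. f n - Suc 0)"
  by (rule recfn2_comp[of "\<lambda>a k. k - Suc 0" "\<lambda>n. 0"],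
      rule recfn2_recI[where G = "\<lambda>a k r. k" and f = "\<lambda>a. 0"]) (simp | intro recfn_intro)+

lemma recfn_diff [recfn_intro]: "recfn f \<Longrightarrow> recfn g \<Longrightarrow> recfn (\<lambda>n. f n - g n)"
  by (rule recfn2_comp[of "(-)"], rule recfn2_recI[where G = "\<lambda>a k r. r - Suc 0" and f = "\<lambda>a. a"]) (simp | intro recfn_intro)+

lemma recfn_mult [recfn_intro]: "recfn f \<Longrightarrow> recfn g \<Longrightarrow> recfn (\<lambda>n. f n * g n)"
  by (rule recfn2_comp[of "(*)"], rule recfn2_recI[where G = "\<lambda>a k r. a + r" and f = "\<lambda>a. 0"]) (simp | intro recfn_intro)+

section \<open>Decidable predicates, search and division\<close>

definition recpred :: "(nat \<Rightarrow> bool) \<Rightarrow> bool" where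
  "recpred P \<longleftrightarrow> recfn (\<lambda>n. of_bool (P n))"

lemma recfn_if [recfn_intro]:
  assumes "recpred P" "recfn f" "recfn g" shows "recfn (\<lambda>n. if P n then f n else g n)"
proof -
  have "recfn (\<lambda>n. of_bool (P n) * f n + (1 - of_bool (P n)) * g n)"
    using assms unfolding recpred_def by (intro recfn_add recfn_mult recfn_diff recfn_const)
  moreover have "(\<lambda>n. of_bool (P n) * f n + (1 - of_bool (P n)) * g n)
      = (\<lambda>n. if P n then f n else g n)" by auto
  ultimately show ?thesis by simp
qed

lemma recpred_conj [recfn_intro]:
  assumes "recpred P" "recpred Q" shows "recpred (\<lambda>n. P n \<and> Q n)"
  using recfn_mult[OF assms[unfolded recpred_def]] by (simp add: recpred_def of_bool_conj)

text \<open>Truncated subtraction decides the order: it vanishes exactly when the first argument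
  does not exceed the second.\<close>

lemma recpred_le [recfn_intro]:
  assumes "recfn f" "recfn g" shows "recpred (\<lambda>n. f n \<le> g n)"
proof -
  have "recfn (\<lambda>n. 1 - (f n - g n))"
    by (intro recfn_intro assms)
  moreover have "(\<lambda>n. 1 - (f n - g n)) = (\<lambda>n. of_bool (f n \<le> g n))"
    by auto
  ultimately show ?thesis by (simp add: recpred_def)
qed

lemma recpred_less [recfn_intro]: "recfn f \<Longrightarrow> recfn g \<Longrightarrow> recpred (\<lambda>n. f n < g n)"
  using recpred_le[OF recfn_Suc] by (simp add: Suc_le_eq)

lemma recpred_eq [recfn_intro]: "recfn f \<Longrightarrow> recfn g \<Longrightarrow> recpred (\<lambda>n. f n = g n)"
  unfolding order_eq_iff by (intro recfn_intro)

lemma recpred_comp: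
  assumes "recpred P" "recfn f" shows "recpred (\<lambda>n. P (f n))"
  using recfn_comp[OF assms[unfolded recpred_def]] by (simp add: recpred_def)

lemma recfn_Least:
  assumes "recpred (\<lambda>z. Q (fst (prod_decode z)) (snd (prod_decode z)))" "\<And>n. \<exists>k. Q n k"
  shows "recfn (\<lambda>n. LEAST k. Q n k)"
proof -
  \<comment> \<open>\<open>minimize\<close> looks for a zero, so truth is coded by 0 here. The
    function is total, so the search never meets an undefined value.\<close>
  let ?f = "\<lambda>z. Some (1 - of_bool (Q (fst (prod_decode z)) (snd (prod_decode z))) :: nat)"
  have "partial_recursive (minimize ?f)"
    using recfn_diff[OF recfn_const assms(1)[unfolded recpred_def]]
    by (intro partial_recursive.mu) (simp add: recfn_def)
  moreover have "?f (prod_encode (n, k)) = Some 0 \<longleftrightarrow> Q n k" for n k by simp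
  then have "minimize ?f = (\<lambda>n. Some (LEAST k. Q n k))"
    using assms(2) by (auto simp: minimize_def fun_eq_iff simp del: diff_is_0_eq)
  ultimately show ?thesis by (simp add: recfn_def)
qed

text \<open>For \<open>c > 0\<close> the quotient is the least \<open>q\<close> with
  \<open>a < c * Suc q\<close>; for \<open>c = 0\<close> the operation \<open>div\<close> has the
  value 0.\<close>

lemma recfn_div [recfn_intro]:
  assumes "recfn f" shows "recfn (\<lambda>n. f n div c)"
proof (cases "c = 0")
  case True
  then show ?thesis by (simp add: recfn_const)
next
  case False
  have "recfn (\<lambda>a. LEAST q. a < c * Suc q)"
  proof (rule recfn_Least)
    show "\<exists>q. a < c * Suc q" for a
      using False by (intro exI[of _ a]) (cases c, auto)
  qed (intro recfn_intro)
  moreover have "(LEAST q. a < c * Suc q) = a div c" for a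
    using False by (intro Least_equality) (auto simp: dividend_less_times_div mult.commute
      less_mult_imp_div_less div_less_iff_less_mult less_Suc_eq_le[symmetric])
  ultimately have "recfn (\<lambda>a. a div c)" by simp
  then show ?thesis using assms by (rule recfn_comp)
qed

section \<open>Computably enumerable sets\<close>

lemma comp_enumI: "partial_recursive f \<Longrightarrow> (\<And>n. n \<in> A \<longleftrightarrow> f n \<noteq> None) \<Longrightarrow> comp_enum A"
  unfolding comp_enum_def by (intro exI[of _ f]) auto

lemma comp_enumE:
  assumes "comp_enum A"
  obtains f where "partial_recursive f" "\<And>n. n \<in> A \<longleftrightarrow> f n \<noteq> None"
  using assms unfolding comp_enum_def by auto

lemma comp_enum_Int:
  assumes "comp_enum A" "comp_enum C" shows "comp_enum (A \<inter> C)"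
proof -
  obtain f where f: "partial_recursive f" "\<And>n. n \<in> A \<longleftrightarrow> f n \<noteq> None"
    using comp_enumE[OF assms(1)] by blast
  obtain g where g: "partial_recursive g" "\<And>n. n \<in> C \<longleftrightarrow> g n \<noteq> None"
    using comp_enumE[OF assms(2)] by blast
  show ?thesis
    by (rule comp_enumI[OF partial_recursive.pair[OF f(1) g(1)]])
      (simp add: f(2) g(2) bind_eq_None_conv)
qed

text \<open>A search whose test ignores the search variable halts at once where \<open>P\<close>
  holds and runs forever elsewhere.\<close>

lemma comp_enum_recpred:
  assumes "recpred P" shows "comp_enum {n. P n}"
proof -
  let ?m = "\<lambda>z. Some (1 - of_bool (P (fst (prod_decode z))) :: nat)"
  have "partial_recursive (minimize ?m)"
    using recfn_diff[OF recfn_const recpred_comp[OF assms recfn_fst_decode, unfolded recpred_def]]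
    by (intro partial_recursive.mu) (simp add: recfn_def)
  then show ?thesis
    by (rule comp_enumI) (simp add: minimize_def)
qed

lemma comp_enum_vimage:
  assumes "comp_enum A" "recfn g" shows "comp_enum {n. g n \<in> A}"
proof -
  obtain f where f: "partial_recursive f" "\<And>n. n \<in> A \<longleftrightarrow> f n \<noteq> None"
    using comp_enumE[OF assms(1)] by blast
  show ?thesis
    by (rule comp_enumI[OF partial_recursive.comp[OF f(1) assms(2)[unfolded recfn_def]]]) (simp add: f(2))
qed

text \<open>First compute \<open>f\<close>, then run a semi-decision procedure for equality on the
  result and the proposed value. Where \<open>f\<close> is undefined the composition is undefined as
  well.\<close>

lemma comp_enum_graph:
  assumes "partial_recursive f"
  shows "comp_enum {z. f (fst (prod_decode z)) = Some (snd (prod_decode z))}"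
proof -
  have "recpred (\<lambda>z. fst (prod_decode z) = snd (prod_decode z))"
    by (intro recfn_intro)
  then obtain e where
    e: "partial_recursive e" "\<And>z. z \<in> {z. fst (prod_decode z) = snd (prod_decode z)} \<longleftrightarrow> e z \<noteq> None"
    using comp_enumE[OF comp_enum_recpred] by blast
  have e': "e (prod_encode (a, b)) \<noteq> None \<longleftrightarrow> a = b" for a b
    using e(2)[of "prod_encode (a, b)"] by (simp only: mem_Collect_eq prod_encode_inverse fst_conv snd_conv)
  show ?thesis
  proof (rule comp_enumI[OF partial_recursive.comp[OF e(1) partial_recursive.pair[OF
          partial_recursive.comp[OF assms partial_recursive.left] partial_recursive.right]]])
    fix z
    show "z \<in> {z. f (fst (prod_decode z)) = Some (snd (prod_decode z))} \<longleftrightarrow>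
        Option.bind (Option.bind (Option.bind (Some (fst (prod_decode z))) f)
          (\<lambda>a. Option.bind (Some (snd (prod_decode z))) (\<lambda>b. Some (prod_encode (a, b))))) e \<noteq> None"
      by (cases "f (fst (prod_decode z))") (simp_all add: e' del: not_None_eq)
  qed
qed

section \<open>Recursive integer-valued functions\<close>

definition recint :: "(nat \<Rightarrow> int) \<Rightarrow> bool" where
  "recint g \<longleftrightarrow> recfn (\<lambda>n. int_encode (g n))"

lemma recint_diff_nat:
  assumes "recfn f" "recfn g" shows "recint (\<lambda>n. int (f n) - int (g n))"
proof -
  \<comment> \<open>This unfolds \<open>int_encode\<close>: a nonnegative \<open>i\<close> has the
    code \<open>2 * i\<close>, a negative one the code \<open>2 * (- i - 1) + 1\<close>.\<close>
  have "recfn (\<lambda>n. if g n \<le> f n then 2 * (f n - g n) else Suc (2 * (g n - f n - 1)))"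
    by (intro recfn_intro assms)
  moreover have "int_encode (int (f n) - int (g n))
     = (if g n \<le> f n then 2 * (f n - g n) else Suc (2 * (g n - f n - 1)))" for n
    by (auto simp: int_encode_def sum_encode_def)
  ultimately show ?thesis by (simp add: recint_def)
qed

text \<open>Parity is phrased as \<open>m = 2 * (m div 2)\<close>, which the closure rules can
  treat. An odd code \<open>m\<close> stands for \<open>- (m div 2) - 1\<close>.\<close>

lemma int_decode_diff:
  "int_decode m = int (if m = 2 * (m div 2) then m div 2 else 0)
                - int (if m = 2 * (m div 2) then 0 else Suc (m div 2))"
proof (cases "even m")
  case True
  then have "m = 2 * (m div 2)" by simp
  then show ?thesis using True by (simp add: int_decode_def sum_decode_def)
next
  case False
  then have "m \<noteq> 2 * (m div 2)" by presburger
  then show ?thesis using False by (simp add: int_decode_def sum_decode_def)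
qed

text \<open>Splitting an integer into a difference of naturals reduces sums, products and
  comparisons of integers to arithmetic on naturals.\<close>

lemma recintE:
  assumes "recint g"
  obtains p q where "recfn p" "recfn q" "g = (\<lambda>n. int (p n) - int (q n))"
proof -
  let ?m = "\<lambda>n. int_encode (g n)"
  have m: "recfn ?m" using assms by (simp add: recint_def)
  show ?thesis
  proof (rule that)
    show "recfn (\<lambda>n. if ?m n = 2 * (?m n div 2) then ?m n div 2 else 0)"
      "recfn (\<lambda>n. if ?m n = 2 * (?m n div 2) then 0 else Suc (?m n div 2))"
      by (intro recfn_intro m)+
  qed (simp add: int_decode_diff[symmetric])
qed

lemma recint_decode [recfn_intro]: "recfn f \<Longrightarrow> recint (\<lambda>n. int_decode (f n))"
  by (simp add: recint_def)

lemma recint_int [recfn_intro]: "recfn f \<Longrightarrow> recint (\<lambda>n. int (f n))"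
  using recint_diff_nat[of f "\<lambda>n. 0"] by (simp add: recfn_const)

lemma recint_const [recfn_intro]: "recint (\<lambda>n. c)"
  by (simp add: recint_def recfn_const)

lemma recint_add [recfn_intro]:
  assumes "recint f" "recint g" shows "recint (\<lambda>n. f n + g n)"
proof -
  obtain p q where f: "recfn p" "recfn q" "f = (\<lambda>n. int (p n) - int (q n))"
    using assms(1) by (rule recintE)
  obtain r s where g: "recfn r" "recfn s" "g = (\<lambda>n. int (r n) - int (s n))"
    using assms(2) by (rule recintE)
  have "recint (\<lambda>n. int (p n + r n) - int (q n + s n))"
    using f g by (intro recint_diff_nat recfn_intro)
  moreover have "(\<lambda>n. int (p n + r n) - int (q n + s n)) = (\<lambda>n. f n + g n)"
    by (auto simp: f g)
  ultimately show ?thesis by simp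
qed

lemma recint_mult [recfn_intro]:
  assumes "recint f" "recint g" shows "recint (\<lambda>n. f n * g n)"
proof -
  obtain p q where f: "recfn p" "recfn q" "f = (\<lambda>n. int (p n) - int (q n))"
    using assms(1) by (rule recintE)
  obtain r s where g: "recfn r" "recfn s" "g = (\<lambda>n. int (r n) - int (s n))"
    using assms(2) by (rule recintE)
  have "recint (\<lambda>n. int (p n * r n + q n * s n) - int (p n * s n + q n * r n))"
    using f g by (intro recint_diff_nat recfn_intro)
  moreover have "(\<lambda>n. int (p n * r n + q n * s n) - int (p n * s n + q n * r n)) = (\<lambda>n. f n * g n)"
    by (auto simp: f g algebra_simps)
  ultimately show ?thesis by simp
qed

lemma recpred_le_int:
  assumes "recint f" "recint g" shows "recpred (\<lambda>n. f n \<le> g n)"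
proof -
  obtain p q where f: "recfn p" "recfn q" "f = (\<lambda>n. int (p n) - int (q n))"
    using assms(1) by (rule recintE)
  obtain r s where g: "recfn r" "recfn s" "g = (\<lambda>n. int (r n) - int (s n))"
    using assms(2) by (rule recintE)
  have "recpred (\<lambda>n. p n + s n \<le> r n + q n)"
    by (intro recfn_intro f g)
  moreover have "(\<lambda>n. p n + s n \<le> r n + q n) = (\<lambda>n. f n \<le> g n)"
    by (auto simp: f g)
  ultimately show ?thesis by simp
qed

section \<open>Recursive rational-valued functions\<close>

text \<open>A rational has many codes under \<open>nat_to_rat_surj\<close>, so computability asks
  for some recursive choice of codes.\<close>

definition recrat :: "(nat \<Rightarrow> rat) \<Rightarrow> bool" where
  "recrat g \<longleftrightarrow> (\<exists>h. recfn h \<and> (\<forall>n. nat_to_rat_surj (h n) = g n))"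

lemma recrat_Fract [recfn_intro]:
  assumes "recint a" "recint b" shows "recrat (\<lambda>n. Fract (a n) (b n))"
  unfolding recrat_def
  using assms by (intro exI[of _ "\<lambda>n. prod_encode (int_encode (a n), int_encode (b n))"])
    (auto simp: recint_def nat_to_rat_surj_def intro: recfn_pair)

text \<open>A code with denominator 0 denotes the rational 0 and is replaced by 0 / 1. The
  denominators are then nonzero everywhere, as the rules for adding, multiplying and comparing
  fractions require.\<close>

lemma recratE:
  assumes "recrat g"
  obtains a b where "recint a" "recint b" "\<forall>n. b n \<noteq> 0" "g = (\<lambda>n. Fract (a n) (b n))"
proof -
  obtain h where h: "recfn h" "\<And>n. nat_to_rat_surj (h n) = g n"
    using assms unfolding recrat_def by blast
  let ?x = "\<lambda>n. fst (prod_decode (h n))" and ?y = "\<lambda>n. snd (prod_decode (h n))"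
  have *: "int_decode m = 0 \<longleftrightarrow> m = 0" for m
    using int_decode_eq[of m 0] by (simp add: int_decode_def sum_decode_def)
  show ?thesis
  proof (rule that)
    show "recint (\<lambda>n. int_decode (if ?y n = 0 then 0 else ?x n))"
      "recint (\<lambda>n. int_decode (if ?y n = 0 then int_encode 1 else ?y n))"
      by (intro recfn_intro h(1))+
    show "\<forall>n. int_decode (if ?y n = 0 then int_encode 1 else ?y n) \<noteq> 0"
      by (simp add: * int_encode_def sum_encode_def)
    have "g n = Fract (int_decode (if ?y n = 0 then 0 else ?x n)) (int_decode (if ?y n = 0 then int_encode 1 else ?y n))" for n
      using *[of 0] unfolding h(2)[symmetric] nat_to_rat_surj_def
      by (auto simp: case_prod_beta' Let_def eq_rat rat_number_collapse)
    then show "g = (\<lambda>n. Fract (int_decode (if ?y n = 0 then 0 else ?x n)) (int_decode (if ?y n = 0 then int_encode 1 else ?y n)))"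
      by blast
  qed
qed

lemma recrat_surj [recfn_intro]: "recfn h \<Longrightarrow> recrat (\<lambda>n. nat_to_rat_surj (h n))"
  unfolding recrat_def by blast

lemma recrat_const [recfn_intro]: "recrat (\<lambda>n. c)"
  using surj_nat_to_rat_surj recrat_surj[OF recfn_const] by (metis surjD)

lemma recrat_of_int [recfn_intro]:
  assumes "recint f" shows "recrat (\<lambda>n. of_int (f n))"
  using recrat_Fract[OF assms recint_const[of 1]] by (simp add: of_int_rat)

lemma recrat_of_nat [recfn_intro]: "recfn f \<Longrightarrow> recrat (\<lambda>n. of_nat (f n))"
  using recrat_of_int[OF recint_int] by simp

lemma recrat_add [recfn_intro]:
  assumes "recrat f" "recrat g" shows "recrat (\<lambda>n. f n + g n)"
proof -
  obtain a b where f: "recint a" "recint b" "\<forall>n. b n \<noteq> 0" "f = (\<lambda>n. Fract (a n) (b n))"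
    using assms(1) by (rule recratE)
  obtain c d where g: "recint c" "recint d" "\<forall>n. d n \<noteq> 0" "g = (\<lambda>n. Fract (c n) (d n))"
    using assms(2) by (rule recratE)
  show ?thesis unfolding f g by (simp only: add_rat f g not_False_eq_True) (intro recfn_intro f g)
qed

lemma recrat_mult [recfn_intro]:
  assumes "recrat f" "recrat g" shows "recrat (\<lambda>n. f n * g n)"
proof -
  obtain a b where f: "recint a" "recint b" "\<forall>n. b n \<noteq> 0" "f = (\<lambda>n. Fract (a n) (b n))"
    using assms(1) by (rule recratE)
  obtain c d where g: "recint c" "recint d" "\<forall>n. d n \<noteq> 0" "g = (\<lambda>n. Fract (c n) (d n))"
    using assms(2) by (rule recratE)
  show ?thesis unfolding f g by (simp only: mult_rat f g not_False_eq_True) (intro recfn_intro f g)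
qed

lemma recrat_uminus [recfn_intro]: "recrat f \<Longrightarrow> recrat (\<lambda>n. - f n)"
  using recrat_mult[OF recrat_const[of "-1"]] by simp

lemma recrat_diff [recfn_intro]: "recrat f \<Longrightarrow> recrat g \<Longrightarrow> recrat (\<lambda>n. f n - g n)"
  using recrat_add[OF _ recrat_uminus] by simp

lemma recpred_le_rat [recfn_intro]:
  assumes "recrat f" "recrat g" shows "recpred (\<lambda>n. f n \<le> g n)"
proof -
  obtain a b where f: "recint a" "recint b" "\<forall>n. b n \<noteq> 0" "f = (\<lambda>n. Fract (a n) (b n))"
    using assms(1) by (rule recratE)
  obtain c d where g: "recint c" "recint d" "\<forall>n. d n \<noteq> 0" "g = (\<lambda>n. Fract (c n) (d n))"
    using assms(2) by (rule recratE)
  show ?thesis unfolding f g by (simp only: le_rat f g not_False_eq_True) (intro recpred_le_int recfn_intro f g)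
qed

lemma recpred_eq_rat [recfn_intro]: "recrat f \<Longrightarrow> recrat g \<Longrightarrow> recpred (\<lambda>n. f n = g n)"
  unfolding order_eq_iff by (intro recfn_intro)

lemma recrat_if [recfn_intro]:
  assumes "recpred P" "recrat f" "recrat g" shows "recrat (\<lambda>n. if P n then f n else g n)"
proof -
  obtain h k where "recfn h" "\<And>n. nat_to_rat_surj (h n) = f n" "recfn k" "\<And>n. nat_to_rat_surj (k n) = g n"
    using assms unfolding recrat_def by blast
  then show ?thesis
    using assms(1) unfolding recrat_def by (intro exI[of _ "\<lambda>n. if P n then h n else k n"]) (auto intro: recfn_if)
qed

lemma recrat_abs [recfn_intro]: "recrat f \<Longrightarrow> recrat (\<lambda>n. \<bar>f n\<bar>)"
proof -
  assume "recrat f"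
  then have "recrat (\<lambda>n. if 0 \<le> f n then f n else - f n)"
    by (intro recfn_intro)
  moreover have "(\<lambda>n. if 0 \<le> f n then f n else - f n) = (\<lambda>n. \<bar>f n\<bar>)"
    by auto
  ultimately show ?thesis by simp
qed

text \<open>The recursion is carried out on codes by \<open>G'\<close>; induction on the counter
  shows that the code reached always denotes \<open>F a k\<close>.\<close>

lemma recrat_rec:
  assumes "recrat f" "recfn h"
    and G: "recrat (\<lambda>z. G (fst (prod_decode z)) (fst (prod_decode (snd (prod_decode z))))
                         (nat_to_rat_surj (snd (prod_decode (snd (prod_decode z))))))"
    and F: "\<And>a. F a 0 = f a" "\<And>a k. F a (Suc k) = G a k (F a k)"
  shows "recrat (\<lambda>n. F n (h n))"
proof -
  obtain f' where f': "recfn f'" "\<And>n. nat_to_rat_surj (f' n) = f n"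
    using assms(1) unfolding recrat_def by blast
  obtain G' where G': "recfn G'" "\<And>z. nat_to_rat_surj (G' z)
      = G (fst (prod_decode z)) (fst (prod_decode (snd (prod_decode z))))
                         (nat_to_rat_surj (snd (prod_decode (snd (prod_decode z)))))"
    using G unfolding recrat_def by blast
  let ?R = "\<lambda>a. rec_nat (f' a) (\<lambda>k r. G' (prod_encode (a, prod_encode (k, r))))"
  have "recfn2 ?R"
    by (intro recfn2_rec_nat recfn_intro f'(1) recfn_comp[OF G'(1)])
  then have "recfn (\<lambda>n. ?R n (h n))"
    using assms(2) by (rule recfn2_comp[OF _ recfn_id])
  moreover have "nat_to_rat_surj (?R a k) = F a k" for a k
    by (induction k) (auto simp: f' G' F)
  ultimately show ?thesis unfolding recrat_def by blast
qed

lemma recrat_power [recfn_intro]: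
  assumes "recrat f" "recfn h" shows "recrat (\<lambda>n. f n ^ h n)"
proof (rule recrat_rec[where F = "\<lambda>a k. f a ^ k" and G = "\<lambda>a k r. f a * r" and f = "\<lambda>_. 1"])
  obtain f' where f': "recfn f'" "\<And>n. nat_to_rat_surj (f' n) = f n"
    using assms(1) unfolding recrat_def by blast
  show "recrat (\<lambda>z. f (fst (prod_decode z)) * nat_to_rat_surj (snd (prod_decode (snd (prod_decode z)))))"
    unfolding f'(2)[symmetric] by (intro recfn_intro recfn_comp[OF f'(1)])
qed (use assms in \<open>simp_all add: recrat_const\<close>)

lemma recrat_comp: "recrat f \<Longrightarrow> recfn g \<Longrightarrow> recrat (\<lambda>n. f (g n))"
  unfolding recrat_def by (metis recfn_comp)

lemma recrat_sum:
  assumes "recrat (\<lambda>z. g (fst (prod_decode z)) (snd (prod_decode z)))" "recfn h"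
  shows "recrat (\<lambda>n. \<Sum>j<h n. g n j)"
proof (rule recrat_rec[where F = "\<lambda>a k. \<Sum>j<k. g a j" and G = "\<lambda>a k r. r + g a k" and f = "\<lambda>_. 0"])
  have "recrat (\<lambda>z. g (fst (prod_decode z)) (fst (prod_decode (snd (prod_decode z)))))"
    using recrat_comp[OF assms(1), of "\<lambda>z. prod_encode (fst (prod_decode z), fst (prod_decode (snd (prod_decode z))))"]
    by (simp add: recfn_pair recfn_fst recfn_snd recfn_id)
  then show "recrat (\<lambda>z. nat_to_rat_surj (snd (prod_decode (snd (prod_decode z))))
      + g (fst (prod_decode z)) (fst (prod_decode (snd (prod_decode z)))))"
    by (intro recfn_intro)
qed (use assms in \<open>simp_all add: recrat_const\<close>)

section \<open>Coded lists and coded bit strings\<close>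

lemma list_decode_unfold:
  "list_decode l = (if l = 0 then [] else fst (prod_decode (l - 1)) # list_decode (snd (prod_decode (l - 1))))"
  by (cases l) (auto simp: case_prod_beta')

lemma length_list_decode: "length (list_decode l) \<le> l"
proof (induction l rule: less_induct)
  case (less l)
  show ?case
  proof (cases l)
    case (Suc n)
    have "snd (prod_decode n) \<le> n"
      by (metis le_prod_encode_2 prod.collapse prod_decode_inverse)
    then show ?thesis
      using less.IH[of "snd (prod_decode n)"] Suc by (simp add: case_prod_beta')
  qed simp
qed

text \<open>Horner evaluation recurses along a list, primitive recursion along a number. The bridge
  is a sum over \<open>j < l n\<close>, padded with zero terms behind the end of the list; by
  \<open>length_list_decode\<close> the code itself is a large enough bound.\<close>

lemma recrat_horner:
  assumes c: "recrat c" and l: "recfn l" and q: "recrat q"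
  shows "recrat (\<lambda>n. horner_sum c (q n) (list_decode (l n)))"
proof -
  \<comment> \<open>\<open>T a k\<close> codes the list coded by \<open>a\<close> without its first
    \<open>k\<close> entries.\<close>
  define T where "T = (\<lambda>l k. ((\<lambda>l. snd (prod_decode (l - Suc 0))) ^^ k) l)"
  have T0: "T a 0 = a" "T a (Suc k) = snd (prod_decode (T a k - Suc 0))" for a k
    by (auto simp: T_def)
  have "recfn2 T"
    by (rule recfn2_recI[where f = "\<lambda>a. a" and G = "\<lambda>a k r. snd (prod_decode (r - Suc 0))"])
      (simp add: T0 | intro recfn_intro)+
  note T = recfn2_comp[OF this]
  \<comment> \<open>The code 0 of the empty list is a fixed point, because
    \<open>0 - Suc 0 = 0\<close> and \<open>prod_decode 0 = (0, 0)\<close>. So the terms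
    \<open>t a j\<close> past the end are 0.\<close>
  have T0': "T 0 k = 0" for k
    by (induction k) (auto simp: T0 prod_decode_def prod_decode_aux.simps)
  have TSuc: "T a (Suc k) = T (snd (prod_decode (a - Suc 0))) k" for a k
    by (induction k) (simp_all add: T0)
  define t where "t = (\<lambda>a j. if T a j = 0 then 0 else c (fst (prod_decode (T a j - Suc 0))))"
  have horner: "horner_sum c r (list_decode a) = (\<Sum>j<N. t a j * r ^ j)"
    if "length (list_decode a) \<le> N" for a N r
    using that
  proof (induction N arbitrary: a)
    case 0
    then show ?case by simp
  next
    case (Suc N)
    show ?case
    proof (cases "a = 0")
      case True
      then show ?thesis by (simp add: t_def T0')
    next
      case False
      let ?b = "snd (prod_decode (a - 1))"
      have t: "t a 0 = c (fst (prod_decode (a - 1)))" "\<And>j. t a (Suc j) = t ?b j"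
        using False by (auto simp: t_def TSuc T0(1))
      have "length (list_decode ?b) \<le> N"
        using Suc.prems False by (subst (asm) list_decode_unfold) simp
      from Suc.IH[OF this] show ?thesis using False
        by (subst list_decode_unfold)
          (simp add: sum.lessThan_Suc_shift t sum_distrib_left algebra_simps del: sum.lessThan_Suc)
    qed
  qed
  have "recrat (\<lambda>z. t (l (fst (prod_decode z))) (snd (prod_decode z)) * q (fst (prod_decode z)) ^ snd (prod_decode z))"
  proof -
    have *: "recfn (\<lambda>z. T (l (fst (prod_decode z))) (snd (prod_decode z)))"
      by (intro T recfn_comp[OF l] recfn_fst_decode recfn_snd_decode)
    have "recrat (\<lambda>z. c (fst (prod_decode (T (l (fst (prod_decode z))) (snd (prod_decode z)) - Suc 0))))"
      by (intro recrat_comp[OF c] recfn_intro *)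
    then have "recrat (\<lambda>z. t (l (fst (prod_decode z))) (snd (prod_decode z)))"
      unfolding t_def by (intro recfn_intro *)
    moreover have "recrat (\<lambda>z. q (fst (prod_decode z)) ^ snd (prod_decode z))"
      by (intro recrat_power recrat_comp[OF q] recfn_fst_decode recfn_snd_decode)
    ultimately show ?thesis by (rule recrat_mult)
  qed
  from recrat_sum[OF this l] show ?thesis
    by (simp add: horner[OF length_list_decode])
qed

text \<open>With all coefficients 1 and the point 1 the Horner sum is the length. Taking the least
  natural above it turns the rational value back into a natural.\<close>

lemma recfn_length_list_decode:
  assumes "recfn l" shows "recfn (\<lambda>n. length (list_decode (l n)))"
proof -
  have len: "horner_sum (\<lambda>_. 1) 1 xs = rat_of_nat (length xs)" for xs :: "nat list"
    by (induction xs) auto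
  have "recfn (\<lambda>n. LEAST k. horner_sum (\<lambda>_. 1) 1 (list_decode (l n)) \<le> rat_of_nat k)"
  proof (rule recfn_Least)
    show "recpred (\<lambda>z. horner_sum (\<lambda>_. 1) 1 (list_decode (l (fst (prod_decode z)))) \<le> rat_of_nat (snd (prod_decode z)))"
      by (intro recfn_intro recrat_horner recfn_comp[OF assms])
  qed (auto simp: len)
  moreover have "(LEAST k. horner_sum (\<lambda>_. 1) 1 (list_decode (l n)) \<le> rat_of_nat k) = length (list_decode (l n))" for n
    by (intro Least_equality) (auto simp: len)
  ultimately show ?thesis by simp
qed

lemma list_decode_string_code: "list_decode (string_code p) = map of_bool p"
  by (simp add: string_code_def)

text \<open>With weight 1 for entries above 1 and the point 1, the Horner sum counts the entries
  that are not bits.\<close>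

lemma recpred_string_code:
  assumes "recfn l" shows "recpred (\<lambda>n. l n \<in> range string_code)"
proof -
  let ?h = "horner_sum (\<lambda>k. if k \<le> 1 then 0 else 1) (1 :: rat)"
  have nonneg: "0 \<le> ?h xs" for xs :: "nat list"
    by (induction xs) auto
  have zero: "?h xs = 0 \<longleftrightarrow> (\<forall>x\<in>set xs. x \<le> 1)" for xs :: "nat list"
  proof (induction xs)
    case (Cons x xs)
    then show ?case using nonneg[of xs] by auto
  qed simp
  have "l n \<in> range string_code \<longleftrightarrow> ?h (list_decode (l n)) = 0" for n
  proof
    assume "?h (list_decode (l n)) = 0"
    then have "map of_bool (map (\<lambda>x. x = 1) (list_decode (l n))) = list_decode (l n)"
      by (auto simp: zero le_Suc_eq simp del: One_nat_def intro!: map_idI)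
    then have "string_code (map (\<lambda>x. x = 1) (list_decode (l n))) = l n"
      by (metis string_code_def list_decode_inverse)
    then show "l n \<in> range string_code" by (metis rangeI)
  qed (auto simp: zero list_decode_string_code simp del: One_nat_def)
  moreover have "recpred (\<lambda>n. ?h (list_decode (l n)) = 0)"
    by (intro recfn_intro recrat_horner assms)
  ultimately show ?thesis by simp
qed

section \<open>Binary expansions\<close>

text \<open>The dyadic rational \<open>0.\<sigma>\<close> in base two; the division by 2 is there
  because \<open>horner_sum\<close> starts with the power 0.\<close>

definition binary_value :: "bool list \<Rightarrow> real" where
  "binary_value \<sigma> = horner_sum of_bool (1 / 2) \<sigma> / 2"

lemma binary_value_bounds: "0 \<le> binary_value \<sigma> \<and> binary_value \<sigma> \<le> 1"
proof -
  have "0 \<le> horner_sum of_bool (1 / 2 :: real) \<sigma> \<and> horner_sum of_bool (1 / 2 :: real) \<sigma> \<le> 2"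
    by (induction \<sigma>) auto
  then show ?thesis by (simp add: binary_value_def)
qed

lemma of_rat_horner_string_code:
  "real_of_rat (horner_sum of_nat (1 / 2) (list_decode (string_code \<sigma>)) * (1 / 2)) = binary_value \<sigma>"
proof -
  have "real_of_rat (horner_sum of_nat (1 / 2) (map of_bool \<sigma>)) = horner_sum of_bool (1 / 2) \<sigma>"
    by (induction \<sigma>) (auto simp: of_rat_add of_rat_mult of_rat_divide)
  then show ?thesis
    by (simp add: binary_value_def list_decode_string_code of_rat_mult of_rat_divide)
qed

lemma floor_double: "\<lfloor>2 * y\<rfloor> = 2 * \<lfloor>y\<rfloor> + of_bool (odd \<lfloor>2 * y\<rfloor>)" for y :: real
proof -
  have "\<lfloor>2 * y\<rfloor> = 2 * \<lfloor>y\<rfloor> \<or> \<lfloor>2 * y\<rfloor> = 2 * \<lfloor>y\<rfloor> + 1"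
    by linarith
  then show ?thesis by auto
qed

lemma binary_value_snoc: "binary_value (\<sigma> @ [a]) = binary_value \<sigma> + of_bool a / 2 ^ Suc (length \<sigma>)"
proof -
  have "horner_sum of_bool (1 / 2 :: real) (\<sigma> @ [a])
      = horner_sum of_bool (1 / 2) \<sigma> + (1 / 2) ^ length \<sigma> * of_bool a"
    by (induction \<sigma>) (auto simp: field_simps)
  then show ?thesis
    by (simp add: binary_value_def power_divide field_simps)
qed

text \<open>Truncation after \<open>n\<close> bits is rounding down at scale \<open>2 ^ n\<close>;
  in the induction \<open>floor_double\<close> supplies the next bit. As \<open>bits\<close> sees
  only the fractional part, \<open>x\<close> lies in the unit interval without 1.\<close>

lemma binary_value_bits:
  assumes "0 \<le> x" "x < 1"
  shows "binary_value (bits x n) = of_int \<lfloor>x * 2 ^ n\<rfloor> / 2 ^ n"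
proof (induction n)
  case 0
  have "\<lfloor>x\<rfloor> = 0" using assms by linarith
  then show ?case by (simp add: bits_def binary_value_def)
next
  case (Suc n)
  have "\<lfloor>x * 2 ^ Suc n\<rfloor> = 2 * \<lfloor>x * 2 ^ n\<rfloor> + of_bool (odd \<lfloor>x * 2 ^ Suc n\<rfloor>)"
    using floor_double[of "x * 2 ^ n"] by (simp add: mult_ac)
  then have "real_of_int \<lfloor>x * 2 ^ Suc n\<rfloor> = 2 * of_int \<lfloor>x * 2 ^ n\<rfloor> + of_bool (odd \<lfloor>x * 2 ^ Suc n\<rfloor>)"
    by (metis (no_types) of_int_add of_int_mult of_int_numeral of_int_of_bool)
  moreover have "bits x (Suc n) = bits x n @ [odd \<lfloor>x * 2 ^ Suc n\<rfloor>]" "length (bits x n) = n"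
    by (simp_all add: bits_def)
  ultimately show ?case
    by (simp only: binary_value_snoc Suc.IH) (simp add: field_simps)
qed

lemma length_bits: "length (bits x n) = n"
  by (simp add: bits_def)

lemma binary_value_bits_close:
  assumes "0 \<le> x" "x < 1"
  shows "\<bar>x - binary_value (bits x n)\<bar> \<le> (1 / 2) ^ n"
proof -
  have "\<bar>x * 2 ^ n - of_int \<lfloor>x * 2 ^ n\<rfloor>\<bar> \<le> 1" by linarith
  then have "\<bar>x * 2 ^ n - of_int \<lfloor>x * 2 ^ n\<rfloor>\<bar> / 2 ^ n \<le> 1 / 2 ^ n"
    by (intro divide_right_mono) auto
  also have "\<bar>x * 2 ^ n - of_int \<lfloor>x * 2 ^ n\<rfloor>\<bar> / 2 ^ n = \<bar>x - of_int \<lfloor>x * 2 ^ n\<rfloor> / 2 ^ n\<bar>"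
  proof -
    have "x - of_int \<lfloor>x * 2 ^ n\<rfloor> / 2 ^ n = (x * 2 ^ n - of_int \<lfloor>x * 2 ^ n\<rfloor>) / 2 ^ n"
      by (simp add: diff_divide_distrib)
    then show ?thesis by (simp add: abs_divide)
  qed
  finally show ?thesis
    by (simp add: binary_value_bits[OF assms] power_divide)
qed

section \<open>Tests on the values of a path at two rational points\<close>

lemma rat_poly_of_rat:
  assumes "0 \<le> x" "x \<le> 1"
  shows "rat_poly i (of_rat x) = of_rat (horner_sum nat_to_rat_surj x (list_decode i))"
proof -
  have "horner_sum (\<lambda>k. of_rat (nat_to_rat_surj k)) (of_rat x :: real) xs = of_rat (horner_sum nat_to_rat_surj x xs)" for xs
    by (induction xs) (simp_all add: of_rat_add of_rat_mult)
  then show ?thesis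
    using assms by (simp add: rat_poly_def)
qed

lemma dist_le_mdist_C01:
  assumes "f \<in> mspace C01" "g \<in> mspace C01" "t \<in> {0..1}"
  shows "\<bar>f t - g t\<bar> \<le> mdist C01 f g"
proof -
  have "continuous_on {0..1} (\<lambda>t. \<bar>f t - g t\<bar>)"
    using assms(1,2) unfolding mspace_C01 by (auto intro!: continuous_intros)
  then have "bdd_above ((\<lambda>t. \<bar>f t - g t\<bar>) ` {0..1})"
    by (intro bounded_imp_bdd_above compact_imp_bounded compact_continuous_image) auto
  then show ?thesis
    unfolding mdist_C01[OF assms(1,2)] using assms(3) by (intro cSUP_upper) auto
qed

text \<open>The functional \<open>f u + b * f v\<close> is 2-Lipschitz for the sup norm. This gives
  the margin of twice the radius by which a ball is certified to lie inside an event.\<close>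

lemma linear_functional_diff:
  fixes f p :: "real \<Rightarrow> real"
  assumes "\<bar>f u - p u\<bar> \<le> d" "\<bar>f v - p v\<bar> \<le> d" "\<bar>b\<bar> \<le> 1"
  shows "\<bar>\<bar>f u + b * f v - g\<bar> - \<bar>p u + b * p v - g\<bar>\<bar> \<le> 2 * d"
proof -
  have "\<bar>b * (f v - p v)\<bar> \<le> 1 * d"
    unfolding abs_mult using assms by (intro mult_mono) auto
  moreover have "(f u + b * f v - g) - (p u + b * p v - g) = (f u - p u) + b * (f v - p v)"
    by (simp add: algebra_simps)
  ultimately show ?thesis
    using assms(1) by linarith
qed

text \<open>
  The witness \<open>w\<close> is stored in the numerator of the code of the radius of a ball, since every
  radius \<open>1 / J\<close> has the codes \<open>(w + 1) / ((w + 1) * J)\<close>. So membership of a ball in the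
  enumeration is a conjunction of \<open>(m, w) \<in> A\<close> and a decidable condition, and no
  search over \<open>w\<close> is needed.
\<close>

lemma ml_random_avoids:
  fixes q r b g e :: "nat \<Rightarrow> rat"
  assumes S: "S = (\<lambda>z. {f \<in> mspace C01. \<bar>f (of_rat (q z)) + of_rat (b z) * f (of_rat (r z)) - of_rat (g z)\<bar>
                                     < of_rat (e z)})"
    and B: "ml_random C01 rat_poly P B" and A: "comp_enum A"
    and rec: "recrat q" "recrat r" "recrat b" "recrat g" "recrat e"
    and range: "\<And>z. z \<in> A \<Longrightarrow> 0 \<le> q z \<and> q z \<le> 1 \<and> 0 \<le> r z \<and> r z \<le> 1 \<and> \<bar>b z\<bar> \<le> 1"
    and meas: "\<And>m. emeasure P (\<Union>w\<in>{w. prod_encode (m, w) \<in> A}. S (prod_encode (m, w))) \<le> ennreal ((1 / 2) ^ m)"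
  obtains m where "\<And>w. prod_encode (m, w) \<in> A \<Longrightarrow> B \<notin> S (prod_encode (m, w))"
proof -
  define H where "H = (\<lambda>i x. horner_sum nat_to_rat_surj x (list_decode i) :: rat)"
  \<comment> \<open>\<open>y\<close> recovers \<open>(m, w)\<close> from \<open>(m, (i, k))\<close>:
    the numerator of \<open>k\<close> has the code \<open>2 * (w + 1)\<close>, whence the halving
    and the subtraction of 1.\<close>
  define y where "y = (\<lambda>z. prod_encode (fst (prod_decode z),
                             fst (prod_decode (snd (prod_decode (snd (prod_decode z))))) div 2 - 1))"
  \<comment> \<open>All data at the centre of the ball are rational, so this sufficient condition
    for the ball to lie inside the event is decidable.\<close>
  define Q where "Q = (\<lambda>z. \<bar>H (fst (prod_decode (snd (prod_decode z)))) (q (y z))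
      + b (y z) * H (fst (prod_decode (snd (prod_decode z)))) (r (y z)) - g (y z)\<bar>
      + 2 * nat_to_rat_surj (snd (prod_decode (snd (prod_decode z)))) \<le> e (y z))"
  define E where "E = {z. y z \<in> A} \<inter> {z. Q z}"
  define V where "V = (\<lambda>m. \<Union>w\<in>{w. prod_encode (m, w) \<in> A}. S (prod_encode (m, w)))"
  have y: "recfn y" unfolding y_def One_nat_def by (intro recfn_intro)
  have "recpred Q"
    unfolding Q_def H_def
    by (intro recfn_intro recrat_horner recrat_surj recfn_id recrat_comp[OF _ y] rec)
  then have "comp_enum E"
    unfolding E_def by (intro comp_enum_Int comp_enum_recpred comp_enum_vimage A y)
  moreover have "V m = (\<Union>(i, k)\<in>{(i, k). prod_encode (m, prod_encode (i, k)) \<in> E}.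
                      mball_of C01 (rat_poly i) (of_rat (nat_to_rat_surj k)))" (is "_ = ?U") for m
  proof (intro equalityI subsetI)
    fix f assume "f \<in> V m"
    then obtain w where w: "prod_encode (m, w) \<in> A" and f: "f \<in> S (prod_encode (m, w))"
      by (auto simp: V_def)
    define z where "z = prod_encode (m, w)"
    define d where "d = real_of_rat (e z) - \<bar>f (of_rat (q z)) + of_rat (b z) * f (of_rat (r z)) - of_rat (g z)\<bar>"
    have fC: "f \<in> mspace C01" and "d > 0"
      using f unfolding S z_def d_def by auto
    \<comment> \<open>The slack \<open>d\<close> has to cover \<open>2 / J\<close> for replacing
      \<open>f\<close> by the centre of the ball and another \<open>2 / J\<close> for the margin in
      \<open>Q\<close>.\<close>
    then obtain J :: nat where J: "J > 0" "inverse (real J) < d / 4"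
      using reals_Archimedean[of "d / 4"] by (metis zero_less_Suc zero_less_divide_iff zero_less_numeral)
    obtain i where i: "mdist C01 f (rat_poly i) < inverse (real J)"
      using rat_poly_dense[OF fC, of "inverse (real J)"] J by auto
    define k where "k = prod_encode (int_encode (int (Suc w)), int_encode (int (Suc w * J)))"
    have k: "nat_to_rat_surj k = inverse (of_nat J)"
      using J by (simp add: k_def nat_to_rat_surj_def Fract_of_int_quotient divide_simps
          del: of_nat_Suc mult_Suc)
    have k': "fst (prod_decode k) div 2 - 1 = w"
      by (simp add: k_def int_encode_def sum_encode_def nat_add_distrib)
    have yz: "y (prod_encode (m, prod_encode (i, k))) = z"
      using k' by (simp add: y_def z_def)
    have "\<bar>\<bar>f (of_rat (q z)) + of_rat (b z) * f (of_rat (r z)) - of_rat (g z)\<bar>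
          - \<bar>rat_poly i (of_rat (q z)) + of_rat (b z) * rat_poly i (of_rat (r z)) - of_rat (g z)\<bar>\<bar> \<le> 2 * inverse (real J)"
      using range[OF w] i by (intro linear_functional_diff
          order.trans[OF dist_le_mdist_C01[OF fC rat_poly_in_C01] less_imp_le]) (auto simp: z_def)
    then have "\<bar>rat_poly i (of_rat (q z)) + of_rat (b z) * rat_poly i (of_rat (r z)) - of_rat (g z)\<bar>
        + 2 * inverse (real J) \<le> of_rat (e z)"
      using J(2) unfolding d_def by argo
    also have "\<bar>rat_poly i (of_rat (q z)) + of_rat (b z) * rat_poly i (of_rat (r z)) - of_rat (g z)\<bar>
        + 2 * inverse (real J) = of_rat (\<bar>H i (q z) + b z * H i (r z) - g z\<bar> + 2 * nat_to_rat_surj k)"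
      using range[OF w] by (simp add: H_def rat_poly_of_rat z_def k of_rat_add of_rat_mult of_rat_diff abs_of_rat[symmetric] of_rat_inverse del: abs_of_rat)
    finally have "\<bar>H i (q z) + b z * H i (r z) - g z\<bar> + 2 * nat_to_rat_surj k \<le> e z"
      by (simp only: of_rat_less_eq)
    then have "prod_encode (m, prod_encode (i, k)) \<in> E"
      using w unfolding E_def Q_def by (simp add: yz z_def)
    moreover have "f \<in> mball_of C01 (rat_poly i) (of_rat (nat_to_rat_surj k))"
      using fC i rat_poly_in_C01 by (simp add: k of_rat_inverse mdist_commute del: mspace_cfunspace)
    ultimately show "f \<in> ?U" by blast
  next
    \<comment> \<open>Conversely, the margin in \<open>Q\<close> exceeds the error
      \<open>2 * mdist C01 f (rat_poly i)\<close> for every path \<open>f\<close> in the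
      ball.\<close>
    fix f assume "f \<in> ?U"
    then obtain i k where ik: "prod_encode (m, prod_encode (i, k)) \<in> E"
      "f \<in> mball_of C01 (rat_poly i) (of_rat (nat_to_rat_surj k))" by blast
    then have fC: "f \<in> mspace C01" and lt: "mdist C01 f (rat_poly i) < of_rat (nat_to_rat_surj k)"
      by (simp_all add: mdist_commute del: mspace_cfunspace)
    define w where "w = fst (prod_decode k) div 2 - 1"
    define z where "z = prod_encode (m, w)"
    have yz: "y (prod_encode (m, prod_encode (i, k))) = z"
      by (simp add: y_def z_def w_def)
    have w: "prod_encode (m, w) \<in> A" and le: "\<bar>H i (q z) + b z * H i (r z) - g z\<bar> + 2 * nat_to_rat_surj k \<le> e z"
      using ik(1) unfolding E_def Q_def by (simp_all add: yz) (simp add: z_def)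
    have "\<bar>\<bar>f (of_rat (q z)) + of_rat (b z) * f (of_rat (r z)) - of_rat (g z)\<bar>
          - \<bar>rat_poly i (of_rat (q z)) + of_rat (b z) * rat_poly i (of_rat (r z)) - of_rat (g z)\<bar>\<bar> \<le> 2 * mdist C01 f (rat_poly i)"
      using range[OF w] by (intro linear_functional_diff dist_le_mdist_C01[OF fC rat_poly_in_C01]) (auto simp: z_def)
    moreover have "\<bar>rat_poly i (of_rat (q z)) + of_rat (b z) * rat_poly i (of_rat (r z)) - of_rat (g z)\<bar>
        + 2 * of_rat (nat_to_rat_surj k) = real_of_rat (\<bar>H i (q z) + b z * H i (r z) - g z\<bar> + 2 * nat_to_rat_surj k)"
      using range[OF w] by (simp add: H_def rat_poly_of_rat z_def of_rat_add of_rat_mult of_rat_diff abs_of_rat[symmetric] del: abs_of_rat)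
    moreover have "\<dots> \<le> of_rat (e z)"
      using le by (simp only: of_rat_less_eq)
    ultimately have "\<bar>f (of_rat (q z)) + of_rat (b z) * f (of_rat (r z)) - of_rat (g z)\<bar> < of_rat (e z)"
      using lt by argo
    then have "f \<in> S z"
      unfolding S using fC by blast
    then show "f \<in> V m"
      using w by (auto simp: V_def z_def)
  qed
  ultimately have "ml_test C01 rat_poly P V"
    unfolding ml_test_def unif_eff_open_def using meas by (auto simp: V_def)
  then obtain m where "B \<notin> V m"
    using B unfolding ml_random_def by blast
  then show ?thesis
    by (intro that[of m]) (auto simp: V_def)
qed

section \<open>Increments under Wiener measure\<close>

lemma space_wiener:
  assumes "wiener_measure P" shows "space P = mspace C01"
proof -
  have "sets P = sets (metric_borel C01)"
    using assms unfolding wiener_measure_def by blast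
  then have "space P = space (metric_borel C01)"
    by (rule sets_eq_imp_space_eq)
  then show ?thesis
    by (simp only: metric_borel_def space_measure_of_conv)
qed

lemma wiener_increment:
  assumes "wiener_measure P" "0 \<le> s" "s < t" "t \<le> 1"
  shows "distributed P lborel (\<lambda>f. f t - f s) (normal_density 0 (sqrt (t - s)))"
  using assms unfolding wiener_measure_def by blast

lemma wiener_increment_measurable:
  assumes "wiener_measure P" "0 \<le> s" "s < t" "t \<le> 1"
  shows "(\<lambda>f. f t - f s) \<in> borel_measurable P"
  using distributed_measurable[OF wiener_increment[OF assms]] by simp

text \<open>Markov's inequality for the moment of order \<open>2 * k\<close>; the constant is that
  moment of the standard normal law.\<close>

lemma emeasure_increment_large:
  assumes P: "wiener_measure P" and st: "0 \<le> s" "s < t" "t \<le> 1" and c: "0 < c"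
  shows "emeasure P {f \<in> space P. c < \<bar>f t - f s\<bar>}
           \<le> ennreal (fact (2 * k) / (2 ^ k * fact k) * (t - s) ^ k / c ^ (2 * k))"
proof -
  let ?\<sigma> = "sqrt (t - s)"
  have int: "has_bochner_integral lborel (\<lambda>x. normal_density 0 ?\<sigma> x * x ^ (2 * k) / c ^ (2 * k))
      (fact (2 * k) / ((2 / ?\<sigma>\<^sup>2) ^ k * fact k) / c ^ (2 * k))"
    using normal_moment_even[of ?\<sigma> 0 k] st by (intro has_bochner_integral_divide) auto
  have "emeasure P {f \<in> space P. c < \<bar>f t - f s\<bar>} = emeasure P ((\<lambda>f. f t - f s) -` {x. c < \<bar>x\<bar>} \<inter> space P)"
    by (intro arg_cong[of _ _ "emeasure P"]) auto
  also have "\<dots> = (\<integral>\<^sup>+x. ennreal (normal_density 0 ?\<sigma> x) * indicator {x. c < \<bar>x\<bar>} x \<partial>lborel)"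
    by (intro distributed_emeasure wiener_increment assms) auto
  also have "\<dots> \<le> (\<integral>\<^sup>+x. ennreal (normal_density 0 ?\<sigma> x * x ^ (2 * k) / c ^ (2 * k)) \<partial>lborel)"
  proof (intro nn_integral_mono)
    fix x
    have "normal_density 0 ?\<sigma> x * c ^ (2 * k) \<le> normal_density 0 ?\<sigma> x * x ^ (2 * k)" if "c < \<bar>x\<bar>"
      using power_mono[of c "\<bar>x\<bar>" "2 * k"] that c by (intro mult_left_mono) (auto simp: power_even_abs)
    then show "ennreal (normal_density 0 ?\<sigma> x) * indicator {x. c < \<bar>x\<bar>} x
        \<le> ennreal (normal_density 0 ?\<sigma> x * x ^ (2 * k) / c ^ (2 * k))"
      using c by (auto simp: indicator_def pos_le_divide_eq intro!: ennreal_leI)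
  qed
  also have "\<dots> = ennreal (fact (2 * k) / ((2 / ?\<sigma>\<^sup>2) ^ k * fact k) / c ^ (2 * k))"
    using int c by (subst nn_integral_eq_integral)
      (auto simp: has_bochner_integral_iff intro!: AE_I2 divide_nonneg_nonneg mult_nonneg_nonneg)
  also have "fact (2 * k) / ((2 / ?\<sigma>\<^sup>2) ^ k * fact k) / c ^ (2 * k)
      = fact (2 * k) / (2 ^ k * fact k) * (t - s) ^ k / c ^ (2 * k)"
    using st by (simp add: power_divide)
  finally show ?thesis .
qed

text \<open>Since \<open>sqrt (2 * pi)\<close> is at least 2, the density is at most
  \<open>1 / (2 * sqrt (t - s))\<close>, and the interval has length \<open>2 * c\<close>.\<close>

lemma emeasure_increment_small:
  assumes P: "wiener_measure P" and st: "0 \<le> s" "s < t" "t \<le> 1" and c: "0 \<le> c"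
  shows "emeasure P {f \<in> space P. \<bar>f t - f s\<bar> < c} \<le> ennreal (c / sqrt (t - s))"
proof -
  let ?\<sigma> = "sqrt (t - s)"
  have "2 \<le> sqrt (2 * pi)"
    using pi_ge_two by (intro real_le_rsqrt) simp
  then have le: "normal_density 0 ?\<sigma> x \<le> 1 / (2 * ?\<sigma>)" for x
  proof -
    have "normal_density 0 ?\<sigma> x \<le> 1 / sqrt (2 * pi * ?\<sigma>\<^sup>2) * 1"
      unfolding normal_density_def by (intro mult_left_mono) auto
    also have "\<dots> = 1 / (sqrt (2 * pi) * ?\<sigma>)"
      using st by (simp add: real_sqrt_mult)
    also have "\<dots> \<le> 1 / (2 * ?\<sigma>)"
      using \<open>2 \<le> sqrt (2 * pi)\<close> st by (intro divide_left_mono mult_right_mono mult_pos_pos) auto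
    finally show ?thesis .
  qed
  have "emeasure P {f \<in> space P. \<bar>f t - f s\<bar> < c} = emeasure P ((\<lambda>f. f t - f s) -` {- c<..<c} \<inter> space P)"
    by (intro arg_cong[of _ _ "emeasure P"]) auto
  also have "\<dots> = (\<integral>\<^sup>+x. ennreal (normal_density 0 ?\<sigma> x) * indicator {- c<..<c} x \<partial>lborel)"
    by (intro distributed_emeasure wiener_increment assms) auto
  also have "\<dots> \<le> (\<integral>\<^sup>+x. ennreal (1 / (2 * ?\<sigma>)) * indicator {- c<..<c} x \<partial>lborel)"
    using le by (intro nn_integral_mono mult_right_mono ennreal_leI) auto
  also have "\<dots> = ennreal (1 / (2 * ?\<sigma>)) * ennreal (2 * c)"
    using c by (subst nn_integral_cmult_indicator) auto
  also have "\<dots> = ennreal (c / ?\<sigma>)"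
    using c st by (subst ennreal_mult[symmetric]) auto
  finally show ?thesis .
qed

text \<open>The quantitative half of Borel--Cantelli: it bounds the measure of the tail of events
  that makes up one level of a test.\<close>

lemma emeasure_UN_geometric:
  fixes W :: "nat \<Rightarrow> 'a set"
  assumes W: "\<And>j. W j \<in> sets M" "\<And>j. emeasure M (W j) \<le> ennreal (K * \<rho> ^ j)"
    and K: "0 \<le> K" and \<rho>: "0 \<le> \<rho>" "\<rho> < 1"
  shows "emeasure M (\<Union>j. W j) \<le> ennreal (K / (1 - \<rho>))"
proof -
  have "emeasure M (\<Union>j. W j) \<le> (\<Sum>j. emeasure M (W j))"
    using W by (intro emeasure_subadditive_countably) auto
  also have "\<dots> \<le> (\<Sum>j. ennreal (K * \<rho> ^ j))"
    by (intro suminf_le W) auto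
  also have "\<dots> = ennreal (\<Sum>j. K * \<rho> ^ j)"
    using K \<rho> by (intro suminf_ennreal2 summable_mult summable_geometric) auto
  also have "(\<Sum>j. K * \<rho> ^ j) = K / (1 - \<rho>)"
    using \<rho> by (subst suminf_mult) (auto simp: suminf_geometric)
  finally show ?thesis .
qed

lemma emeasure_finite_UN_le:
  assumes I: "finite I" "real (card I) \<le> K" "\<And>i. i \<in> I \<Longrightarrow> W i \<in> sets M"
    "\<And>i. i \<in> I \<Longrightarrow> emeasure M (W i) \<le> ennreal a" and "0 \<le> a"
  shows "emeasure M (\<Union>i\<in>I. W i) \<le> ennreal (K * a)"
proof -
  have "emeasure M (\<Union>i\<in>I. W i) \<le> (\<Sum>i\<in>I. emeasure M (W i))"
    using I by (intro emeasure_subadditive_finite) auto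
  also have "\<dots> \<le> (\<Sum>i\<in>I. ennreal a)"
    by (intro sum_mono I)
  also have "\<dots> = ennreal (real (card I) * a)"
    using \<open>0 \<le> a\<close> by (simp add: ennreal_mult ennreal_of_nat_eq_real_of_nat)
  also have "\<dots> \<le> ennreal (K * a)"
    using I \<open>0 \<le> a\<close> by (intro ennreal_leI mult_right_mono) auto
  finally show ?thesis .
qed

text \<open>
  Evaluation at 0 is only known to be almost surely 0, so events about \<open>f t\<close> are replaced by
  events about the increment \<open>f t - f 0\<close> up to a null set.
\<close>

lemma emeasure_le_up_to_start:
  assumes P: "wiener_measure P" and W: "W \<in> sets P"
    and sub: "\<And>f. f \<in> V \<Longrightarrow> f 0 = 0 \<Longrightarrow> f \<in> W" and V: "V \<subseteq> space P"
  shows "emeasure P V \<le> emeasure P W"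
proof -
  have "AE f in P. f 0 = 0"
    using P unfolding wiener_measure_def by blast
  then obtain N where N: "{f \<in> space P. f 0 \<noteq> 0} \<subseteq> N" "emeasure P N = 0" "N \<in> sets P"
    by (rule AE_E) auto
  have "emeasure P V \<le> emeasure P (N \<union> W)"
    using N W sub V by (intro emeasure_mono) auto
  also have "\<dots> \<le> emeasure P N + emeasure P W"
    using N W by (intro emeasure_subadditive) auto
  finally show ?thesis using N(2) by simp
qed

section \<open>Random paths\<close>

lemma ex_two_power_ge: "\<exists>c::nat. (x::real) \<le> 2 ^ c"
  by (meson less_imp_le one_less_numeral_iff semiring_norm(76) real_arch_pow)

text \<open>The number \<open>\<rho>\<close> is 2 to the power \<open>- 1 / K\<close>; it allows
  fractional exponents of 2 while all powers stay natural.\<close>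

lemma ex_root_half:
  assumes "0 < K"
  obtains \<rho> :: real where "0 < \<rho>" "\<rho> < 1" "\<rho> ^ K = 1 / 2"
proof
  show "0 < root K (1 / 2)" "root K (1 / 2) < 1" "root K (1 / 2) ^ K = 1 / 2"
    using assms by auto
qed

lemma card_bool_lists_le: "card {p :: bool list. length p \<le> l} \<le> 2 ^ Suc l"
proof -
  have "card {p :: bool list. length p \<le> l} = (\<Sum>i\<le>l. 2 ^ i)"
    using card_lists_length_le[of "UNIV :: bool set" l] by simp
  also have "\<dots> < 2 ^ Suc l"
    by (induction l) auto
  finally show ?thesis by simp
qed

section \<open>The tests for increments, for described points and for the endpoint 1\<close>

text \<open>By the moment bound of order \<open>2 * k\<close> and the assumption on
  \<open>k\<close>, one increment of level \<open>n\<close> is too large with probability at most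
  \<open>M * (1 / 4) ^ n\<close>. The \<open>2 ^ n\<close> increments of that level together
  contribute \<open>M * (1 / 2) ^ n\<close>, which is summable.\<close>

lemma ml_random_increments:
  fixes e :: "nat \<Rightarrow> nat"
  assumes P: "wiener_measure P" and B: "ml_random C01 rat_poly P B"
    and e: "recfn e" and k: "\<And>n. 2 * (e n * k) + 2 * n \<le> n * k"
  obtains N where "\<And>n i. N \<le> n \<Longrightarrow> i < 2 ^ n \<Longrightarrow> \<bar>B (real (Suc i) / 2 ^ n) - B (real i / 2 ^ n)\<bar> \<le> (1 / 2) ^ e n"
proof -
  define M :: real where "M = fact (2 * k) / (2 ^ k * fact k)"
  \<comment> \<open>The levels from \<open>m + c\<close> on have total measure at most
    \<open>2 * M * (1 / 2) ^ (m + c)\<close>, and \<open>c\<close> absorbs the constant.\<close>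
  obtain c where c: "2 * M \<le> 2 ^ c" using ex_two_power_ge by blast
  have M: "0 \<le> M" by (simp add: M_def)
  define n where "n = (\<lambda>z. fst (prod_decode (snd (prod_decode z))))"
  define i where "i = (\<lambda>z. fst (prod_decode (snd (prod_decode (snd (prod_decode z))))))"
  \<comment> \<open>Tests have the form of an upper bound \<open>\<bar>v - g\<bar> < r\<close>,
    while a large increment is a lower bound on \<open>\<bar>v\<bar>\<close>. So that set is covered
    by the intervals around rationals \<open>g\<close> of radius
    \<open>\<bar>g\<bar> - (1 / 2) ^ e n\<close>, and the witness carries a code of
    \<open>g\<close>.\<close>
  define g where "g = (\<lambda>z. nat_to_rat_surj (snd (prod_decode (snd (prod_decode (snd (prod_decode z)))))))"
  \<comment> \<open>The bound on \<open>i z\<close> is stated over the rationals, where the closure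
    rules include powers.\<close>
  define Q where "Q = (\<lambda>z. rat_of_nat (Suc (i z)) \<le> 2 ^ n z \<and> fst (prod_decode z) + c \<le> n z)"
  have rec: "recfn n" "recfn i" "recrat g"
    unfolding n_def i_def g_def by (intro recfn_intro)+
  have Q_iff: "Q z \<longleftrightarrow> i z < 2 ^ n z \<and> fst (prod_decode z) + c \<le> n z" for z
  proof -
    have "rat_of_nat (Suc (i z)) \<le> 2 ^ n z \<longleftrightarrow> rat_of_nat (Suc (i z)) \<le> rat_of_nat (2 ^ n z)"
      by simp
    then show ?thesis unfolding Q_def of_nat_le_iff by (simp add: Suc_le_eq)
  qed
  define S where "S = (\<lambda>z. {f \<in> mspace C01.
      \<bar>f (of_rat (of_nat (Suc (i z)) * (1 / 2) ^ n z)) + of_rat (- 1) * f (of_rat (of_nat (i z) * (1 / 2) ^ n z)) - of_rat (g z)\<bar>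
        < of_rat (\<bar>g z\<bar> - (1 / 2) ^ e (n z))})"
  define D where "D = (\<lambda>n i. {f \<in> space P. (1 / 2) ^ e n < \<bar>f (real (Suc i) / 2 ^ n) - f (real i / 2 ^ n)\<bar>})"
  have pts: "real_of_rat (of_nat j * (1 / 2) ^ m) = real j / 2 ^ m" for j m
    by (simp add: of_rat_mult of_rat_power of_rat_divide power_divide)
  have SD: "f \<in> D (n z) (i z)" if "f \<in> S z" for f z
    using that unfolding S_def D_def space_wiener[OF P] pts
    by (simp add: of_rat_diff of_rat_power of_rat_divide abs_of_rat[symmetric] del: abs_of_rat mspace_cfunspace)
      linarith
  have DS: "\<exists>w. n (prod_encode (m, w)) = k \<and> i (prod_encode (m, w)) = j \<and> f \<in> S (prod_encode (m, w))"
    if "f \<in> D k j" for f m k j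
  proof -
    define v where "v = f (real (Suc j) / 2 ^ k) - f (real j / 2 ^ k)"
    have f: "f \<in> mspace C01" and v: "(1 / 2) ^ e k < \<bar>v\<bar>"
      using that unfolding D_def space_wiener[OF P] v_def by auto
    \<comment> \<open>With \<open>d\<close> half the excess of \<open>\<bar>v\<bar>\<close>, a
      rational within \<open>d\<close> of \<open>v\<close> has a radius greater than
      \<open>d\<close>, so its interval contains \<open>v\<close>.\<close>
    define d where "d = (\<bar>v\<bar> - (1 / 2) ^ e k) / 2"
    have "v < v + d" using v by (simp add: d_def)
    then obtain r where r: "v < of_rat r" "of_rat r < v + d"
      using of_rat_dense by blast
    obtain x where x: "nat_to_rat_surj x = r"
      using surj_nat_to_rat_surj by (metis surjD)
    let ?z = "prod_encode (m, prod_encode (k, prod_encode (j, x)))"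
    have z: "n ?z = k" "i ?z = j" "g ?z = r"
      by (simp_all add: n_def i_def g_def x)
    have "\<bar>v - of_rat r\<bar> < \<bar>of_rat r\<bar> - (1 / 2) ^ e k"
      using r v unfolding d_def by argo
    then have "f \<in> S ?z"
      using f unfolding S_def pts z v_def
      by (simp add: of_rat_diff of_rat_power of_rat_divide abs_of_rat[symmetric] del: abs_of_rat mspace_cfunspace)
    with z show ?thesis by blast
  qed
  have D_sets: "D n i \<in> sets P" and D_le: "emeasure P (D n i) \<le> ennreal (M * (1 / 4) ^ n)" if "i < 2 ^ n" for n i
  proof -
    have st: "0 \<le> real i / 2 ^ n" "real i / 2 ^ n < real (Suc i) / 2 ^ n" "real (Suc i) / 2 ^ n \<le> 1"
    proof -
      have "real (Suc i) \<le> real (2 ^ n)" using that by (intro of_nat_mono) simp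
      then show "real (Suc i) / 2 ^ n \<le> 1" by simp
    qed (auto simp: divide_strict_right_mono)
    note [measurable] = wiener_increment_measurable[OF P st]
    show "D n i \<in> sets P" unfolding D_def by measurable
    have "emeasure P (D n i) \<le> ennreal (M * (real (Suc i) / 2 ^ n - real i / 2 ^ n) ^ k / ((1 / 2) ^ e n) ^ (2 * k))"
      unfolding D_def M_def by (intro emeasure_increment_large P st) simp
    also have "M * (real (Suc i) / 2 ^ n - real i / 2 ^ n) ^ k / ((1 / 2) ^ e n) ^ (2 * k)
        = M * ((1 / 2) ^ (n * k) / (1 / 2) ^ (2 * (e n * k)))"
      by (simp add: diff_divide_distrib[symmetric] power_mult[symmetric] power_divide mult_ac)
    also have "\<dots> \<le> M * (1 / 4) ^ n"
    proof (intro mult_left_mono M)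
      have "(1 / 2 :: real) ^ (n * k) \<le> (1 / 2) ^ (2 * n + 2 * (e n * k))"
        using k[of n] by (intro power_decreasing) auto
      also have "\<dots> = (1 / 4) ^ n * (1 / 2) ^ (2 * (e n * k))"
        by (simp add: power_add power_mult power2_eq_square)
      finally show "(1 / 2) ^ (n * k) / (1 / 2) ^ (2 * (e n * k)) \<le> (1 / 4 :: real) ^ n"
        by (simp add: divide_le_eq)
    qed
    finally show "emeasure P (D n i) \<le> ennreal (M * (1 / 4) ^ n)"
      using ennreal_leI by auto
  qed
  have meas: "emeasure P (\<Union>w\<in>{w. prod_encode (m, w) \<in> {z. Q z}}. S (prod_encode (m, w)))
      \<le> ennreal ((1 / 2) ^ m)" for m
  proof -
    define W where "W = (\<lambda>j. \<Union>i<2 ^ (m + c + j). D (m + c + j) i)"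
    have W: "W j \<in> sets P" for j
      unfolding W_def using D_sets by (intro sets.finite_UN) auto
    have "(\<Union>w\<in>{w. prod_encode (m, w) \<in> {z. Q z}}. S (prod_encode (m, w))) \<subseteq> (\<Union>j. W j)"
    proof safe
      fix w f assume "f \<in> S (prod_encode (m, w))" "Q (prod_encode (m, w))"
      then obtain j where "n (prod_encode (m, w)) = m + c + j" "i (prod_encode (m, w)) < 2 ^ (m + c + j)"
        "f \<in> D (m + c + j) (i (prod_encode (m, w)))"
        using SD[of f "prod_encode (m, w)"] le_Suc_ex[of "m + c" "n (prod_encode (m, w))"]
        by (auto simp: Q_iff)
      then show "f \<in> (\<Union>j. W j)"
        unfolding W_def by blast
    qed
    then have "emeasure P (\<Union>w\<in>{w. prod_encode (m, w) \<in> {z. Q z}}. S (prod_encode (m, w))) \<le> emeasure P (\<Union>j. W j)"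
      using W by (intro emeasure_mono) auto
    also have "\<dots> \<le> ennreal (M * (1 / 2) ^ (m + c) / (1 - 1 / 2))"
    proof (rule emeasure_UN_geometric[OF W])
      fix j
      have "emeasure P (W j) \<le> ennreal (2 ^ (m + c + j) * (M * (1 / 4) ^ (m + c + j)))"
        unfolding W_def using D_sets D_le M by (intro emeasure_finite_UN_le) auto
      also have "2 ^ (m + c + j) * (M * (1 / 4) ^ (m + c + j)) = M * (1 / 2) ^ (m + c + j)"
        by (simp add: power_mult_distrib[symmetric])
      finally show "emeasure P (W j) \<le> ennreal (M * (1 / 2) ^ (m + c) * (1 / 2) ^ j)"
        by (simp add: power_add mult_ac)
    qed (use M in auto)
    also have "M * (1 / 2) ^ (m + c) / (1 - 1 / 2) = 2 * M / 2 ^ c * (1 / 2) ^ m"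
      by (simp add: power_add power_divide mult_ac)
    also have "\<dots> \<le> 1 * (1 / 2) ^ m"
      using c by (intro mult_right_mono) auto
    finally show ?thesis using ennreal_leI by auto
  qed
  obtain m where m: "\<And>w. prod_encode (m, w) \<in> {z. Q z} \<Longrightarrow> B \<notin> S (prod_encode (m, w))"
  proof (rule ml_random_avoids[OF S_def B _ _ _ _ _ _ _ meas])
    show "comp_enum {z. Q z}"
      unfolding Q_def by (intro comp_enum_recpred recfn_intro rec)
    show "recrat (\<lambda>z. of_nat (Suc (i z)) * (1 / 2) ^ n z)" "recrat (\<lambda>z. of_nat (i z) * (1 / 2) ^ n z)"
      "recrat (\<lambda>z. - 1)" "recrat g" "recrat (\<lambda>z. \<bar>g z\<bar> - (1 / 2) ^ e (n z))"
      by (intro recfn_intro rec recfn_comp[OF e])+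
    fix z assume "z \<in> {z. Q z}"
    then have "rat_of_nat (Suc (i z)) \<le> 2 ^ n z" by (simp add: Q_def)
    moreover from this have "rat_of_nat (i z) \<le> 2 ^ n z" unfolding of_nat_Suc by linarith
    ultimately show "0 \<le> of_nat (Suc (i z)) * (1 / 2 :: rat) ^ n z \<and> of_nat (Suc (i z)) * (1 / 2 :: rat) ^ n z \<le> 1 \<and>
        0 \<le> of_nat (i z) * (1 / 2 :: rat) ^ n z \<and> of_nat (i z) * (1 / 2 :: rat) ^ n z \<le> 1 \<and> \<bar>- 1 :: rat\<bar> \<le> 1"
      by (simp add: power_divide divide_le_eq)
  qed blast
  show ?thesis
  proof (rule that[of "m + c"])
    fix k j :: nat assume kj: "m + c \<le> k" "j < 2 ^ k"
    show "\<bar>B (real (Suc j) / 2 ^ k) - B (real j / 2 ^ k)\<bar> \<le> (1 / 2) ^ e k"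
    proof (rule ccontr)
      assume "\<not> ?thesis"
      then have "B \<in> D k j"
        using B unfolding D_def space_wiener[OF P] ml_random_def by auto
      from DS[OF this, of m] kj m show False by (auto simp: Q_iff)
    qed
  qed
qed

text \<open>At level \<open>n\<close> at most \<open>2 ^ Suc (b * n div K)\<close> programs compete.
  Each gives an event of measure at most \<open>2 ^ c * (1 / 2) ^ e n * 2 ^ d\<close>, where
  \<open>2 ^ d\<close> controls the density at points not below \<open>(1 / 2) ^ d\<close>. The
  assumption on \<open>K\<close> makes the product at most a constant times
  \<open>\<rho> ^ n\<close>.\<close>

lemma ml_random_described_points:
  fixes e :: "nat \<Rightarrow> nat" and U :: "bool list \<Rightarrow> bool list option"
  assumes P: "wiener_measure P" and B: "ml_random C01 rat_poly P B" and U: "partial_computable U"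
    and e: "recfn e" and K: "0 < K" "\<And>n. n + b * n \<le> K * Suc (e n)"
  obtains N where "\<And>p \<sigma>. U p = Some \<sigma> \<Longrightarrow> K * length p \<le> b * length \<sigma> \<Longrightarrow> N \<le> length \<sigma> \<Longrightarrow>
      (1 / 2) ^ d \<le> binary_value \<sigma> \<Longrightarrow> 2 ^ c * (1 / 2) ^ e (length \<sigma>) \<le> \<bar>B (binary_value \<sigma>)\<bar>"
proof -
  obtain \<rho> :: real where \<rho>: "0 < \<rho>" "\<rho> < 1" "\<rho> ^ K = 1 / 2"
    using ex_root_half[OF K(1)] .
  \<comment> \<open>Besides \<open>c\<close> for the radius and \<open>d\<close> for the density,
    the 2 in the exponent pays for the \<open>Suc\<close> in the count of programs and for the
    rounding in \<open>Suc (e n)\<close>.\<close>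
  define M :: real where "M = 2 ^ (c + d + 2)"
  \<comment> \<open>The level \<open>m\<close> of the test starts at length
    \<open>K * (m + c')\<close>, where \<open>\<rho>\<close> has the power
    \<open>(1 / 2) ^ (m + c')\<close>.\<close>
  obtain c' where c': "M / (1 - \<rho>) \<le> 2 ^ c'" using ex_two_power_ge by blast
  obtain F where F: "partial_recursive F" "\<And>p. F (string_code p) = map_option string_code (U p)"
    using U unfolding partial_computable_def by blast
  define p s where "p = (\<lambda>z. fst (prod_decode (snd (prod_decode z))))"
    and "s = (\<lambda>z. snd (prod_decode (snd (prod_decode z))))"
  have rec: "recfn p" "recfn s"
    unfolding p_def s_def by (intro recfn_intro)+
  define len where "len = (\<lambda>l. length (list_decode l))"
  have rec_len: "recfn (\<lambda>z. len (f z))" if "recfn f" for f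
    unfolding len_def by (rule recfn_length_list_decode[OF that])
  define v where "v = (\<lambda>z. horner_sum of_nat (1 / 2) (list_decode (s z)) * (1 / 2) :: rat)"
  \<comment> \<open>\<open>F\<close> is controlled only on codes of bit strings, so the program must
    be such a code; the output is then one as well.\<close>
  define Q where "Q = (\<lambda>z. p z \<in> range string_code \<and> K * len (p z) \<le> b * len (s z) \<and>
      K * (fst (prod_decode z) + c') \<le> len (s z) \<and> (1 / 2) ^ d \<le> v z)"
  define A where "A = {z. snd (prod_decode z) \<in> {y. F (fst (prod_decode y)) = Some (snd (prod_decode y))}} \<inter> {z. Q z}"
  define good where "good = (\<lambda>m q \<sigma>. U q = Some \<sigma> \<and> K * length q \<le> b * length \<sigma> \<and>
      K * (m + c') \<le> length \<sigma> \<and> (1 / 2) ^ d \<le> binary_value \<sigma>)"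
  have half_le: "(1 / 2) ^ d \<le> x \<longleftrightarrow> (1 / 2) ^ d \<le> real_of_rat x" for x
  proof -
    have "(1 / 2 :: real) ^ d = of_rat ((1 / 2) ^ d)"
      by (simp add: of_rat_power of_rat_divide)
    then show ?thesis by (simp only: of_rat_less_eq)
  qed
  have len_code: "len (string_code q) = length q" for q
    by (simp add: len_def list_decode_string_code)
  have v_code: "real_of_rat (v (prod_encode (m, prod_encode (x, string_code \<sigma>)))) = binary_value \<sigma>" for m x \<sigma>
    by (simp only: v_def s_def prod_encode_inverse snd_conv of_rat_horner_string_code)
  have A_iff: "prod_encode (m, w) \<in> A \<longleftrightarrow> (\<exists>q \<sigma>. w = prod_encode (string_code q, string_code \<sigma>) \<and> good m q \<sigma>)" for m w
  proof
    assume "prod_encode (m, w) \<in> A"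
    then have Fw: "F (fst (prod_decode w)) = Some (snd (prod_decode w))" and Q: "Q (prod_encode (m, w))"
      by (simp_all add: A_def)
    then obtain q where q: "fst (prod_decode w) = string_code q"
      by (auto simp: Q_def p_def)
    then obtain \<sigma> where \<sigma>: "U q = Some \<sigma>" "snd (prod_decode w) = string_code \<sigma>"
      using Fw by (auto simp: F)
    have "w = prod_encode (string_code q, string_code \<sigma>)"
      by (metis q \<sigma>(2) prod.collapse prod_decode_inverse)
    with Q \<sigma>(1) have "w = prod_encode (string_code q, string_code \<sigma>) \<and> good m q \<sigma>"
      unfolding Q_def good_def half_le by (simp add: p_def s_def len_code v_code)
    then show "\<exists>q \<sigma>. w = prod_encode (string_code q, string_code \<sigma>) \<and> good m q \<sigma>"
      by blast
  next
    assume "\<exists>q \<sigma>. w = prod_encode (string_code q, string_code \<sigma>) \<and> good m q \<sigma>"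
    then obtain q \<sigma> where "w = prod_encode (string_code q, string_code \<sigma>)" "good m q \<sigma>"
      by blast
    then show "prod_encode (m, w) \<in> A"
      unfolding A_def Q_def good_def half_le by (simp add: F p_def s_def len_code v_code)
  qed
  \<comment> \<open>The coefficient 0 turns the two-point functional into evaluation at one
    point.\<close>
  define S where "S = (\<lambda>z. {f \<in> mspace C01. \<bar>f (of_rat (v z)) + of_rat 0 * f (of_rat 0) - of_rat 0\<bar>
                                     < of_rat (2 ^ c * (1 / 2) ^ e (len (s z)))})"
  have S_iff: "f \<in> S (prod_encode (m, prod_encode (q, string_code \<sigma>))) \<longleftrightarrow>
      f \<in> mspace C01 \<and> \<bar>f (binary_value \<sigma>)\<bar> < 2 ^ c * (1 / 2) ^ e (length \<sigma>)" for f m q \<sigma>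
    unfolding S_def v_code by (simp add: s_def len_code of_rat_mult of_rat_power of_rat_divide del: mspace_cfunspace)
  have meas: "emeasure P (\<Union>w\<in>{w. prod_encode (m, w) \<in> A}. S (prod_encode (m, w)))
      \<le> ennreal ((1 / 2) ^ m)" for m
  proof -
    \<comment> \<open>The events are indexed by programs, so that counting programs bounds their
      number. They concern the increment from 0, whose law is known.\<close>
    define D where "D = (\<lambda>q. {f \<in> space P. \<bar>f (binary_value (the (U q))) - f 0\<bar> < 2 ^ c * (1 / 2) ^ e (length (the (U q)))})"
    define I where "I = (\<lambda>n. {q. \<exists>\<sigma>. good m q \<sigma> \<and> length \<sigma> = n})"
    define W where "W = (\<lambda>j. \<Union>q\<in>I (K * (m + c') + j). D q)"
    have D_sets: "D q \<in> sets P"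
      and D_le: "emeasure P (D q) \<le> ennreal (2 ^ c * (1 / 2) ^ e n * 2 ^ d)" if qI: "q \<in> I n" for q n
    proof -
      obtain \<sigma> where \<sigma>: "good m q \<sigma>" "length \<sigma> = n" using qI unfolding I_def by blast
      then have Uq: "the (U q) = \<sigma>" and pos: "(1 / 2) ^ d \<le> binary_value \<sigma>" by (auto simp: good_def)
      then have t: "0 < binary_value \<sigma>" "binary_value \<sigma> \<le> 1"
        using binary_value_bounds[of \<sigma>] less_le_trans[OF _ pos, of 0] by simp_all
      note [measurable] = wiener_increment_measurable[OF P order_refl t]
      show "D q \<in> sets P" unfolding D_def Uq by measurable
      have "emeasure P (D q) \<le> ennreal (2 ^ c * (1 / 2) ^ e n / sqrt (binary_value \<sigma> - 0))"
        unfolding D_def Uq \<sigma>(2) by (intro emeasure_increment_small P t) auto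
      also have "\<dots> \<le> ennreal (2 ^ c * (1 / 2) ^ e n * 2 ^ d)"
      proof (rule ennreal_leI)
        \<comment> \<open>As the point is at most 1, its square root is at least the point itself,
          hence at least \<open>(1 / 2) ^ d\<close>.\<close>
        have "binary_value \<sigma> * binary_value \<sigma> \<le> binary_value \<sigma> * 1"
          using t by (intro mult_left_mono) auto
        then have "(1 / 2) ^ d \<le> sqrt (binary_value \<sigma>)"
          using t by (intro order.trans[OF pos] real_le_rsqrt) (simp add: power2_eq_square)
        then have "1 / sqrt (binary_value \<sigma>) \<le> 2 ^ d"
          using t by (simp add: power_divide field_simps)
        then show "2 ^ c * (1 / 2) ^ e n / sqrt (binary_value \<sigma> - 0) \<le> 2 ^ c * (1 / 2) ^ e n * 2 ^ d"
          using mult_left_mono[of "1 / sqrt (binary_value \<sigma>)" "2 ^ d" "2 ^ c * (1 / 2) ^ e n"] by simp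
      qed
      finally show "emeasure P (D q) \<le> ennreal (2 ^ c * (1 / 2) ^ e n * 2 ^ d)" .
    qed
    have I_sub: "I n \<subseteq> {q. length q \<le> b * n div K}" for n
      using K(1) by (auto simp: I_def good_def less_eq_div_iff_mult_less_eq mult.commute)
    have fin: "finite {q :: bool list. length q \<le> l}" for l
      using finite_lists_length_le[of "UNIV :: bool set" l] by simp
    have I: "finite (I n)" "real (card (I n)) \<le> 2 ^ Suc (b * n div K)" for n
    proof -
      show "finite (I n)" using finite_subset[OF I_sub fin] .
      have "card (I n) \<le> 2 ^ Suc (b * n div K)"
        using card_mono[OF fin I_sub] card_bool_lists_le order.trans by blast
      then have "real (card (I n)) \<le> real (2 ^ Suc (b * n div K))" by (rule of_nat_mono)
      then show "real (card (I n)) \<le> 2 ^ Suc (b * n div K)" by simp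
    qed
    have W: "W j \<in> sets P" for j
      unfolding W_def using D_sets I by (intro sets.finite_UN) auto
    have "emeasure P (\<Union>w\<in>{w. prod_encode (m, w) \<in> A}. S (prod_encode (m, w))) \<le> emeasure P (\<Union>j. W j)"
    proof (rule emeasure_le_up_to_start[OF P])
      fix f assume "f \<in> (\<Union>w\<in>{w. prod_encode (m, w) \<in> A}. S (prod_encode (m, w)))" and f0: "f 0 = 0"
      then obtain q \<sigma> where good: "good m q \<sigma>" and
        f: "f \<in> S (prod_encode (m, prod_encode (string_code q, string_code \<sigma>)))"
        unfolding A_iff by blast
      obtain j where j: "length \<sigma> = K * (m + c') + j"
        using good le_Suc_ex unfolding good_def by blast
      have "f \<in> D q"
        using f f0 good unfolding S_iff D_def space_wiener[OF P] by (simp add: good_def del: mspace_cfunspace)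
      moreover have "q \<in> I (K * (m + c') + j)"
        using good j unfolding I_def by blast
      ultimately show "f \<in> (\<Union>j. W j)" unfolding W_def by blast
    next
      show "(\<Union>w\<in>{w. prod_encode (m, w) \<in> A}. S (prod_encode (m, w))) \<subseteq> space P"
        unfolding S_def space_wiener[OF P] by blast
    qed (use W in auto)
    also have "\<dots> \<le> ennreal (M * (1 / 2) ^ (m + c') / (1 - \<rho>))"
    proof (rule emeasure_UN_geometric[OF W])
      fix j
      let ?n = "K * (m + c') + j"
      let ?l = "b * ?n div K"
      have "emeasure P (W j) \<le> ennreal (2 ^ Suc ?l * (2 ^ c * (1 / 2) ^ e ?n * 2 ^ d))"
        unfolding W_def using D_sets D_le I by (intro emeasure_finite_UN_le) auto
      also have "2 ^ Suc ?l * (2 ^ c * (1 / 2) ^ e ?n * 2 ^ d) \<le> M * \<rho> ^ ?n"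
      proof -
        have "K * ?l \<le> b * ?n" by simp
        then have n: "?n + K * ?l \<le> K * Suc (e ?n)" using K(2)[of ?n] by linarith
        have "(1 / 2) ^ Suc (e ?n) = \<rho> ^ (K * Suc (e ?n))"
          by (simp only: power_mult \<rho>(3))
        also have "\<dots> \<le> \<rho> ^ (?n + K * ?l)"
          using n \<rho> by (intro power_decreasing) auto
        also have "\<dots> = \<rho> ^ ?n * (1 / 2) ^ ?l"
          by (simp only: power_add power_mult \<rho>(3))
        finally have "2 ^ ?l * (1 / 2) ^ Suc (e ?n) \<le> 2 ^ ?l * (\<rho> ^ ?n * (1 / 2) ^ ?l)"
          by (intro mult_left_mono) auto
        also have "\<dots> = \<rho> ^ ?n"
          by (simp add: power_divide)
        finally have "M * (2 ^ ?l * (1 / 2) ^ Suc (e ?n)) \<le> M * \<rho> ^ ?n"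
          by (intro mult_left_mono) (auto simp: M_def)
        then show ?thesis by (simp add: M_def power_add mult_ac)
      qed
      also have "\<rho> ^ ?n = (1 / 2) ^ (m + c') * \<rho> ^ j"
        by (simp only: power_add power_mult \<rho>(3))
      finally show "emeasure P (W j) \<le> ennreal (M * (1 / 2) ^ (m + c') * \<rho> ^ j)"
        by (simp only: mult_ac) (simp add: ennreal_leI)
    qed (use \<rho> in \<open>auto simp: M_def\<close>)
    also have "M * (1 / 2) ^ (m + c') / (1 - \<rho>) = M / (1 - \<rho>) / 2 ^ c' * (1 / 2) ^ m"
      by (simp add: power_add power_divide mult_ac)
    also have "\<dots> \<le> 1 * (1 / 2) ^ m"
      using c' by (intro mult_right_mono) (auto simp: divide_le_eq simp del: divide_divide_eq_left)
    finally show ?thesis using ennreal_leI by auto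
  qed
  obtain m where m: "\<And>w. prod_encode (m, w) \<in> A \<Longrightarrow> B \<notin> S (prod_encode (m, w))"
  proof (rule ml_random_avoids[OF S_def B _ _ _ _ _ _ _ meas])
    show "comp_enum A"
      unfolding A_def Q_def v_def
      by (intro comp_enum_Int comp_enum_vimage comp_enum_graph comp_enum_recpred F recpred_string_code
          recfn_intro recrat_horner rec rec_len)
    show "recrat v" "recrat (\<lambda>z. 0)" "recrat (\<lambda>z. 0)" "recrat (\<lambda>z. 0)" "recrat (\<lambda>z. 2 ^ c * (1 / 2) ^ e (len (s z)))"
      unfolding v_def by (intro recfn_intro recrat_horner rec recfn_comp[OF e] rec_len)+
    fix z assume "z \<in> A"
    moreover obtain m w where z: "z = prod_encode (m, w)" by (metis prod.collapse prod_decode_inverse)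
    ultimately obtain q \<sigma> where "z = prod_encode (m, prod_encode (string_code q, string_code \<sigma>))"
      using A_iff[of m w] by auto
    then have "real_of_rat (v z) = binary_value \<sigma>"
      by (simp only: v_code)
    then have "0 \<le> v z \<and> v z \<le> 1"
      using binary_value_bounds[of \<sigma>] by (simp flip: \<open>real_of_rat (v z) = binary_value \<sigma>\<close>)
    then show "0 \<le> v z \<and> v z \<le> 1 \<and> 0 \<le> (0 :: rat) \<and> 0 \<le> (1 :: rat) \<and> \<bar>0 :: rat\<bar> \<le> 1"
      by simp
  qed blast
  show ?thesis
  proof (rule that[of "K * (m + c')"])
    fix q \<sigma>
    assume "U q = Some \<sigma>" "K * length q \<le> b * length \<sigma>" "K * (m + c') \<le> length \<sigma>"
      "(1 / 2) ^ d \<le> binary_value \<sigma>"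
    then have "prod_encode (m, prod_encode (string_code q, string_code \<sigma>)) \<in> A"
      unfolding A_iff good_def by blast
    from m[OF this] show "2 ^ c * (1 / 2) ^ e (length \<sigma>) \<le> \<bar>B (binary_value \<sigma>)\<bar>"
      using B unfolding S_iff ml_random_def by auto
  qed
qed

text \<open>The event \<open>\<bar>f 1\<bar> < (1 / 2) ^ m\<close> has measure at most
  \<open>(1 / 2) ^ m\<close> by the small-ball estimate for variance 1. The witness \<open>w\<close>
  is a dummy.\<close>

lemma ml_random_nonzero_at_1:
  assumes P: "wiener_measure P" and B: "ml_random C01 rat_poly P B"
  shows "B 1 \<noteq> 0"
proof -
  define S where "S = (\<lambda>z. {f \<in> mspace C01. \<bar>f (of_rat 1) + of_rat 0 * f (of_rat 0) - of_rat 0\<bar>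
                                     < of_rat ((1 / 2) ^ fst (prod_decode z))})"
  have S_iff: "f \<in> S (prod_encode (m, w)) \<longleftrightarrow> f \<in> mspace C01 \<and> \<bar>f 1\<bar> < (1 / 2) ^ m" for f m w
    unfolding S_def by (simp add: of_rat_power of_rat_divide del: mspace_cfunspace)
  have meas: "emeasure P (\<Union>w\<in>{w. prod_encode (m, w) \<in> UNIV}. S (prod_encode (m, w)))
      \<le> ennreal ((1 / 2) ^ m)" for m
  proof -
    note [measurable] = wiener_increment_measurable[OF P order_refl zero_less_one order_refl]
    have "emeasure P (\<Union>w\<in>{w. prod_encode (m, w) \<in> UNIV}. S (prod_encode (m, w)))
        \<le> emeasure P {f \<in> space P. \<bar>f 1 - f 0\<bar> < (1 / 2) ^ m}"
    proof (rule emeasure_le_up_to_start[OF P])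
      show "{f \<in> space P. \<bar>f 1 - f 0\<bar> < (1 / 2) ^ m} \<in> sets P" by measurable
    qed (auto simp: S_iff space_wiener[OF P] simp del: mspace_cfunspace)
    also have "\<dots> \<le> ennreal ((1 / 2) ^ m / sqrt (1 - 0))"
      by (intro emeasure_increment_small P) auto
    finally show ?thesis by simp
  qed
  obtain m where m: "\<And>w. prod_encode (m, w) \<in> UNIV \<Longrightarrow> B \<notin> S (prod_encode (m, w))"
  proof (rule ml_random_avoids[OF S_def B _ _ _ _ _ _ _ meas])
    show "comp_enum UNIV"
      by (rule comp_enumI[OF partial_recursive.zero]) simp
  qed (auto intro!: recfn_intro)
  show ?thesis
    using B m unfolding S_iff ml_random_def by force
qed

section \<open>Chaining from a zero and the resulting contradiction\<close>

text \<open>Telescope along the truncations of \<open>x\<close>, which converge to \<open>x\<close>.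
  Superadditivity of \<open>e\<close> lets the factor \<open>(1 / 2) ^ e n\<close> be pulled out of
  the sum of the increments, and the rest is bounded by \<open>C\<close>.\<close>

lemma dyadic_chaining:
  assumes x: "0 \<le> x" "x < 1" and cont: "continuous_on {0..1} B"
    and e: "\<And>m n. e m + e n \<le> e (m + n)" and C: "\<And>j. (\<Sum>i<j. (1 / 2) ^ e (Suc i)) \<le> (C :: real)"
    and inc: "\<And>n i. N \<le> n \<Longrightarrow> i < 2 ^ n \<Longrightarrow> \<bar>B (real (Suc i) / 2 ^ n) - B (real i / 2 ^ n)\<bar> \<le> (1 / 2) ^ e n"
    and n: "N \<le> n"
  shows "\<bar>B x - B (binary_value (bits x n))\<bar> \<le> C * (1 / 2) ^ e n"
proof -
  define a where "a = (\<lambda>n. binary_value (bits x n))"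
  have step: "\<bar>B (a (Suc n)) - B (a n)\<bar> \<le> (1 / 2) ^ e (Suc n)" if "N \<le> n" for n
  proof -
    have "0 \<le> \<lfloor>x * 2 ^ n\<rfloor>" using x by simp
    then obtain i where i: "\<lfloor>x * 2 ^ n\<rfloor> = int i" by (rule nonneg_int_cases)
    have "real i \<le> x * 2 ^ n" using i by linarith
    also have "\<dots> < 1 * 2 ^ n" using x by (intro mult_strict_right_mono) auto
    finally have "real i < real (2 ^ n)" by simp
    then have "2 * i < 2 ^ Suc n" by (simp only: of_nat_less_iff) simp
    \<comment> \<open>On the grid of level \<open>n + 1\<close> the truncation has an even index, so
      the next truncation is the same point or its right neighbour.\<close>
    have an: "a n = real (2 * i) / 2 ^ Suc n"
      using i by (simp add: a_def binary_value_bits[OF x])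
    have "a (Suc n) = a n + of_bool (odd \<lfloor>x * 2 ^ Suc n\<rfloor>) / 2 ^ Suc n"
      using binary_value_snoc[of "bits x n"] by (simp add: a_def bits_def)
    then have "a (Suc n) = a n \<or> a (Suc n) = real (Suc (2 * i)) / 2 ^ Suc n"
      unfolding an by (auto simp: add_divide_distrib)
    then show ?thesis
      using inc[of "Suc n" "2 * i"] that \<open>2 * i < 2 ^ Suc n\<close> by (auto simp: an)
  qed
  have "\<bar>B (a (n + j)) - B (a n)\<bar> \<le> (\<Sum>i<j. (1 / 2) ^ e (n + Suc i))" for j
  proof (induction j)
    case (Suc j)
    show ?case using step[of "n + j"] n Suc by simp
  qed simp
  also have "(\<Sum>i<j. (1 / 2) ^ e (n + Suc i)) \<le> (\<Sum>i<j. (1 / 2 :: real) ^ e n * (1 / 2) ^ e (Suc i))" for j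
    unfolding power_add[symmetric] by (intro sum_mono power_decreasing e) auto
  also have "(\<Sum>i<j. (1 / 2 :: real) ^ e n * (1 / 2) ^ e (Suc i)) \<le> (1 / 2) ^ e n * C" for j
    unfolding sum_distrib_left[symmetric] by (intro mult_left_mono C) auto
  finally have bound: "\<bar>B (a (n + j)) - B (a n)\<bar> \<le> (1 / 2) ^ e n * C" for j .
  have "a \<longlonglongrightarrow> x"
  proof (rule LIMSEQ_I)
    fix r :: real assume "0 < r"
    then obtain m where m: "(1 / 2) ^ m < r"
      using real_arch_pow_inv[of r "1 / 2"] by auto
    have "norm (a n - x) < r" if "m \<le> n" for n
      using binary_value_bits_close[OF x, of n] m that power_decreasing[of m n "1 / 2 :: real"]
      unfolding a_def real_norm_def by linarith
    then show "\<exists>no. \<forall>n\<ge>no. norm (a n - x) < r" by blast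
  qed
  then have "(\<lambda>j. a (n + j)) \<longlonglongrightarrow> x"
    by (subst add.commute) (rule LIMSEQ_ignore_initial_segment)
  then have "(\<lambda>j. B (a (n + j))) \<longlonglongrightarrow> B x"
    using x binary_value_bounds by (intro continuous_on_tendsto_compose[OF cont]) (auto simp: a_def)
  then have "(\<lambda>j. \<bar>B (a (n + j)) - B (a n)\<bar>) \<longlonglongrightarrow> \<bar>B x - B (a n)\<bar>"
    by (intro tendsto_intros)
  then show ?thesis
    using bound unfolding a_def by (intro LIMSEQ_le_const2) (auto simp: mult.commute)
qed

lemma zero_not_described:
  assumes P: "wiener_measure P" and B: "ml_random C01 rat_poly P B" and U: "partial_computable U"
    and x: "0 < x" "x < 1" "B x = 0" and L: "3 \<le> L"
  obtains N where "\<And>n p. N \<le> n \<Longrightarrow> U p = Some (bits x n) \<Longrightarrow> (L - 2) * n < 2 * L * length p"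
proof -
  define K where "K = 2 * L"
  define e where "e = (\<lambda>n. ((L - 1) * n) div K)"
  have "0 < K" using L by (simp add: K_def)
  have rec: "recfn e"
    unfolding e_def by (intro recfn_intro)
  have e_le: "K * e n \<le> (L - 1) * n" for n by (simp add: e_def)
  have e_add: "e m + e n \<le> e (m + n)" for m n
  proof -
    have "K * (e m + e n) \<le> (L - 1) * (m + n)"
      using add_mono[OF e_le[of m] e_le[of n]] by (simp only: add_mult_distrib2)
    then have "e m + e n \<le> (L - 1) * (m + n) div K"
      using \<open>0 < K\<close> by (simp add: less_eq_div_iff_mult_less_eq mult.commute)
    then show ?thesis by (simp only: e_def)
  qed
  have e_ge: "(L - 1) * n \<le> K * Suc (e n)" for n
    using dividend_less_times_div[OF \<open>0 < K\<close>, of "(L - 1) * n"] by (simp add: e_def)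
  \<comment> \<open>The requirement of the increment test, with \<open>K\<close> itself as the
    parameter \<open>k\<close> of the moment bound.\<close>
  have 1: "2 * (e n * K) + 2 * n \<le> n * K" for n
  proof -
    have "2 * (e n * K) + 2 * n \<le> 2 * ((L - 1) * n) + 2 * n"
      using e_le[of n] by (simp add: mult.commute)
    also have "\<dots> = n * K" using L by (cases L) (auto simp: K_def algebra_simps)
    finally show ?thesis .
  qed
  \<comment> \<open>The requirement of the counting test, with \<open>b = L - 2\<close>.\<close>
  have 2: "n + (L - 2) * n \<le> K * Suc (e n)" for n
  proof -
    have "n + (L - 2) * n = Suc (L - 2) * n" by simp
    also have "Suc (L - 2) = L - 1" using L by simp
    finally show ?thesis using e_ge[of n] by simp
  qed
  obtain \<rho> :: real where \<rho>: "0 < \<rho>" "\<rho> < 1" "\<rho> ^ K = 1 / 2"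
    using ex_root_half[OF \<open>0 < K\<close>] .
  define C where "C = 2 / (1 - \<rho>)"
  have C: "(\<Sum>i<j. (1 / 2) ^ e (Suc i)) \<le> C" for j
  proof -
    have "(1 / 2) ^ e (Suc i) \<le> 2 * \<rho> ^ i" for i
    proof -
      have "i \<le> (L - 1) * Suc i" using L by (cases "L - 1") auto
      then have "i \<le> K * Suc (e (Suc i))" using e_ge[of "Suc i"] by linarith
      then have "\<rho> ^ (K * Suc (e (Suc i))) \<le> \<rho> ^ i"
        using \<rho> by (intro power_decreasing) auto
      then show ?thesis by (simp only: power_mult \<rho>(3)) simp
    qed
    then have "(\<Sum>i<j. (1 / 2) ^ e (Suc i)) \<le> (\<Sum>i<j. 2 * \<rho> ^ i)"
      by (intro sum_mono)
    also have "\<dots> = 2 * ((1 - \<rho> ^ j) / (1 - \<rho>))"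
      using \<rho> by (simp add: sum_gp_strict flip: sum_distrib_left)
    also have "\<dots> \<le> C"
      unfolding C_def using \<rho> by (simp add: divide_right_mono)
    finally show ?thesis .
  qed
  \<comment> \<open>The counting test will give \<open>2 ^ c \<le> C\<close> at a described
    truncation of a zero; the added 1 makes this a contradiction.\<close>
  obtain c where c: "C + 1 \<le> 2 ^ c" using ex_two_power_ge by blast
  \<comment> \<open>For \<open>n \<ge> d\<close> the truncation is at least
    \<open>x - (1 / 2) ^ d\<close>, which exceeds \<open>(1 / 2) ^ d\<close>.\<close>
  obtain d where d: "(1 / 2) ^ d < x / 2"
    using real_arch_pow_inv[of "x / 2" "1 / 2"] x by auto
  obtain N1 where N1: "\<And>n i. N1 \<le> n \<Longrightarrow> i < 2 ^ n \<Longrightarrow> \<bar>B (real (Suc i) / 2 ^ n) - B (real i / 2 ^ n)\<bar> \<le> (1 / 2) ^ e n"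
    by (rule ml_random_increments[OF P B rec 1]) blast
  obtain N2 where N2: "\<And>p \<sigma>. U p = Some \<sigma> \<Longrightarrow> K * length p \<le> (L - 2) * length \<sigma> \<Longrightarrow> N2 \<le> length \<sigma> \<Longrightarrow>
      (1 / 2) ^ d \<le> binary_value \<sigma> \<Longrightarrow> 2 ^ c * (1 / 2) ^ e (length \<sigma>) \<le> \<bar>B (binary_value \<sigma>)\<bar>"
    by (rule ml_random_described_points[OF P B U rec \<open>0 < K\<close> 2]) blast
  have cont: "continuous_on {0..1} B"
    using B unfolding ml_random_def mspace_C01 by blast
  show ?thesis
  proof (rule that[of "max d (max N1 N2)"])
    fix n p assume n: "max d (max N1 N2) \<le> n" and p: "U p = Some (bits x n)"
    show "(L - 2) * n < 2 * L * length p"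
    proof (rule ccontr)
      assume "\<not> ?thesis"
      then have le: "K * length p \<le> (L - 2) * n" by (simp add: K_def)
      have "(1 / 2 :: real) ^ n \<le> (1 / 2) ^ d" using n by (intro power_decreasing) auto
      then have "(1 / 2) ^ d \<le> binary_value (bits x n)"
        using binary_value_bits_close[of x n] x d by linarith
      then have "2 ^ c * (1 / 2) ^ e n \<le> \<bar>B (binary_value (bits x n))\<bar>"
        using N2[OF p] le n by (simp add: length_bits)
      also have "\<dots> = \<bar>B x - B (binary_value (bits x n))\<bar>" using x by simp
      also have "\<dots> \<le> C * (1 / 2) ^ e n"
        using x n by (intro dyadic_chaining[OF _ _ cont e_add C N1]) auto
      finally have "2 ^ c \<le> C" by simp
      then show False using c by simp
    qed
  qed
qed

section \<open>From program lengths to effective dimension\<close>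

text \<open>A finite value excludes the empty infimum, and an infimum of a nonempty set in
  \<open>enat\<close> is attained.\<close>

lemma complexity_enat:
  assumes "complexity M \<sigma> = enat k"
  obtains p where "M p = Some \<sigma>" "length p = k"
proof -
  let ?A = "(\<lambda>p. enat (length p)) ` {p. M p = Some \<sigma>}"
  have "?A \<noteq> {}"
    using assms unfolding complexity_def by (auto simp: Inf_enat_def split: if_splits)
  then have "Inf ?A \<in> ?A"
    unfolding Inf_enat_def by (auto intro: LeastI)
  then show ?thesis
    using assms that unfolding complexity_def by auto
qed

theorem theorem4p5:
  fixes P :: "(real \<Rightarrow> real) measure"
    and U :: "bool list \<Rightarrow> bool list option"
    and B :: "real \<Rightarrow> real"
    and x :: real
  assumes "wiener_measure P"
    and "optimal_prefix_free_machine U"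
    and "ml_random C01 rat_poly P B"
    and "x \<in> {t \<in> {0..1}. B t = 0} - {0}"
  shows "cdim U x \<ge> 1 / 2"
proof (rule ccontr)
  have U: "partial_computable U"
    using assms(2) unfolding optimal_prefix_free_machine_def prefix_free_machine_def by blast
  have x: "0 < x" "x < 1" "B x = 0"
    using assms(4) ml_random_nonzero_at_1[OF assms(1,3)] by (auto simp: less_le)
  let ?K = "\<lambda>n. ereal_of_enat (complexity U (bits x n))"
  assume "\<not> 1 / 2 \<le> cdim U x"
  \<comment> \<open>A lower limit below 1/2 means that the ratio stays at or below some
    \<open>y < 1 / 2\<close> for infinitely many \<open>n\<close>.\<close>
  then obtain y where y: "y < 1 / 2" "\<not> (\<forall>\<^sub>F n in sequentially. y < ?K n / ereal (real n))"
    unfolding cdim_def le_Liminf_iff by blast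
  obtain r where r: "y < ereal r" "ereal r < 1 / 2"
    using ereal_dense2[OF y(1)] by blast
  have "r < 1 / 2" using r(2) by (metis ereal_divide ereal_less_eq less_ereal.simps(1) one_ereal_def numeral_eq_ereal zero_neq_numeral)
  then obtain L0 :: nat where L0: "inverse (real (Suc L0)) < 1 / 2 - r"
    using reals_Archimedean[of "1 / 2 - r"] by auto
  \<comment> \<open>The summand 3 gives \<open>3 \<le> L\<close> and keeps \<open>1 / L\<close>
    below \<open>1 / Suc L0\<close>.\<close>
  define L where "L = L0 + 3"
  have L: "3 \<le> L" by (simp add: L_def)
  have "1 / real L \<le> inverse (real (Suc L0))"
    by (simp add: L_def divide_simps)
  then have rL: "r < 1 / 2 - 1 / real L" using L0 by linarith
  obtain N where N: "\<And>n p. N \<le> n \<Longrightarrow> U p = Some (bits x n) \<Longrightarrow> (L - 2) * n < 2 * L * length p"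
    using zero_not_described[OF assms(1,3) U x L] by blast
  obtain n where n: "max 1 N \<le> n" "?K n / ereal (real n) \<le> y"
    using y(2) unfolding eventually_sequentially by (meson not_le)
  have "?K n / ereal (real n) < ereal r" using n(2) r(1) by (rule le_less_trans)
  \<comment> \<open>An infinite complexity would make the ratio infinite; \<open>n \<ge> 1\<close>
    keeps the denominator nonzero.\<close>
  then obtain k where k: "complexity U (bits x n) = enat k" "real k / real n < r"
    using n(1) by (cases "complexity U (bits x n)") auto
  obtain p where p: "U p = Some (bits x n)" "length p = k"
    using complexity_enat[OF k(1)] .
  have "real k < (1 / 2 - 1 / real L) * real n"
    using k(2) rL n(1) by (simp add: divide_less_eq) (smt (verit) mult_right_mono of_nat_0_le_iff)
  then have "2 * real L * real k \<le> 2 * real L * ((1 / 2 - 1 / real L) * real n)"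
    using L by (intro mult_left_mono) auto
  also have "\<dots> = (real L - 2) * real n"
    using L by (simp add: field_simps)
  also have "\<dots> = real ((L - 2) * n)"
    using L by (simp add: of_nat_diff)
  finally have "real (2 * L * k) \<le> real ((L - 2) * n)" by simp
  then have "2 * L * k \<le> (L - 2) * n" by (simp only: of_nat_le_iff)
  with N[of n p] p n(1) show False by simp
qed

end
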